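(* Let $\mathfrak D=(X,U,\mathbb K,\mathsf T)$ be a cdt-MP and let $S,G\in\mathcal B(X)$ be disjoint. Let $\hat{\mathfrak D}$, $\hat J_n$ be the auxiliary cdt-MP and the total cost defined in the context. Then for all $n\in\bar{\mathbb N}_0=\mathbb N_0\cup\{\infty\}$ and $x\in X$ one has $\hat{\mathsf M}^*(x,q^f;\hat J_n)=\hat{\mathsf M}_*(x,q^f;\hat J_n)=0$ and $$\mathsf M^*(x;S\,\mathsf U^nG)=\hat{\mathsf M}^*(x,q^s;\hat J_n),\qquad \mathsf M_*(x;S\,\mathsf U^nG)=\hat{\mathsf M}_*(x,q^s;\hat J_n).$$
   Context: A Borel space is a topological space homeomorphic to a Borel subset of a complete separable metric space; $\mathcal B(Y)$ is its Borel $\sigma$-algebra. A cdt-MP is a tuple $\mathfrak D=(X,U,\mathbb K,\mathsf T)$ with $X,U$ non-empty Borel spaces, $\mathbb K\subseteq X\times U$ an analytic set such that $\mathbb K_x:=\{u\in U:(x,u)\in\mathbb K\}\neq\emptyset$ for all $x\in X$, and $\mathsf T(\cdot|x,u)$ a Borel measurable stochastic kernel on $X$ given $X\times U$. The path space is $H=(X\times U)^{\mathbb N_0}$ and $H_n=(X\times U)^n\times X$ is the space of histories $h_n=(x_0,u_0,\dots,u_{n-1},x_n)$. A policy is a sequence $\pi=(\pi_n)_{n\ge0}$ of universally measurable stochastic kernels $\pi_n$ on $U$ given $H_n$ with $\pi_n(\mathbb K_{x_n}|h_n)=1$ for all $h_n$; $\Pi$ is the set of all policies. $\mathsf P^\pi_x$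 is the unique probability measure on $H$ under which $x_0=x$, the conditional law of $u_n$ given $h_n$ is $\pi_n(\cdot|h_n)$, and the conditional law of $x_{n+1}$ given $(h_n,u_n)$ is $\mathsf T(\cdot|x_n,u_n)$. For a random variable $J$ on $H$: $\mathsf M^\pi(x;J)=\mathsf P^\pi_x[J]$ (expectation), $\mathsf M^*(x;J)=\sup_{\pi\in\Pi}\mathsf M^\pi(x;J)$, $\mathsf M_*(x;J)=\inf_{\pi\in\Pi}\mathsf M^\pi(x;J)$; for an event its indicator is used. $S\,\mathsf U^nG$ is the event that there is a finite $i\in\mathbb N_0$, $i\le n$, with $x_i\in G$ and $x_j\in S$ for all $0\le j<i$. Auxiliary cdt-MP: $\hat{\mathfrak D}=(\hat X,U,\hat{\mathbb K},\hat{\mathsf T})$ with $\hat X=X\times\{q^s,q^f\}$ (discrete second factor), $\hat{\mathbb K}_{(x,q)}=\mathbb K_x$, $\hat{\mathsf T}(A\times B|x,q,u)=1_B(\mathsf t(q,x))\mathsf T(A|x,u)$, where $\mathsf t(q^s,x)=q^s$ if $x\in S$, $\mathsf t(q^s,x)=q^f$ if $x\notin S$, and $\mathsf t(q^f,x)=q^f$ for all $x$. Hatted objects ($\hat\Pi$, $\hat{\mathsf P}$, $\hat{\mathsf M}^*$, $\hat{\mathsf M}_*$) are the corresponding objects for $\hat{\mathfrak D}$, with state process $(x_k,q_k)$. The cost is $c(x,q)=1\{q=q^s\}\cdot1_G(x)$ and $\hat J_n=\sum_{k=0}^nc(x_k,q_k)$ (infinite sum if $n=\infty$). *)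

theory Defs
  imports "HOL-Probability.Probability"
begin

definition borel_of :: "'a topology \<Rightarrow> 'a measure" where
  "borel_of X = sigma (topspace X) {V. openin X V}"

(* HOL cannot quantify over all metric spaces inside a formula. A separable metric space has at
   most continuum many points, so letting its carrier be an arbitrary subset of the set of reals
   (with an arbitrary topology, unrelated to the usual one) loses no generality. *)
definition borel_space :: "'a topology \<Rightarrow> bool" where
  "borel_space X \<longleftrightarrow>
     (\<exists>(Y :: real topology) B. completely_metrizable_space Y \<and> separable_space Y \<and>
        B \<in> sets (borel_of Y) \<and> X homeomorphic_space (subtopology Y B))"

(* Continuous images of Baire space. The type nat => nat carries the product topology of the
   discrete topology on nat. *)
definition analytic_in :: "'a topology \<Rightarrow> 'a set \<Rightarrow> bool" where
  "analytic_in X A \<longleftrightarrow>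
     A = {} \<or> (\<exists>f. continuous_map (euclidean :: (nat \<Rightarrow> nat) topology) X f \<and> A = range f)"

(* Measurability with respect to this sigma-algebra is universal measurability. *)
definition univ_completion :: "'a measure \<Rightarrow> 'a measure" where
  "univ_completion M =
     sigma (space M) {A. A \<subseteq> space M \<and> (\<forall>p \<in> space (prob_algebra M). A \<in> sets (completion p))}"

record ('x, 'u) mp =
  states :: "'x topology"
  actions :: "'u topology"
  admissible :: "('x \<times> 'u) set"
  kernel :: "'x \<times> 'u \<Rightarrow> 'x measure"

abbreviation state_algebra :: "('x, 'u) mp \<Rightarrow> 'x measure" where
  "state_algebra D \<equiv> borel_of (states D)"

abbreviation action_algebra :: "('x, 'u) mp \<Rightarrow> 'u measure" where
  "action_algebra D \<equiv> borel_of (actions D)"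

definition admissible_actions :: "('x, 'u) mp \<Rightarrow> 'x \<Rightarrow> 'u set" where
  "admissible_actions D x = {u \<in> topspace (actions D). (x, u) \<in> admissible D}"

(* Borel spaces are second countable, so here and below the Borel sigma-algebra of a countable
   product coincides with the product sigma-algebra. *)
definition cdt_MP :: "('x, 'u) mp \<Rightarrow> bool" where
  "cdt_MP D \<longleftrightarrow>
     borel_space (states D) \<and> topspace (states D) \<noteq> {} \<and>
     borel_space (actions D) \<and> topspace (actions D) \<noteq> {} \<and>
     analytic_in (prod_topology (states D) (actions D)) (admissible D) \<and>
     (\<forall>x \<in> topspace (states D). admissible_actions D x \<noteq> {}) \<and>
     kernel D \<in> (state_algebra D \<Otimes>\<^sub>M action_algebra D) \<rightarrow>\<^sub>M prob_algebra (state_algebra D)"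

type_synonym ('x, 'u) path = "nat \<Rightarrow> 'x \<times> 'u"

(* A history (x_0, u_0, ..., u_{n-1}, x_n) is a pair (w, x) where w i = (x_i, u_i) for i < n,
   w is undefined beyond, and x = x_n. *)
type_synonym ('x, 'u) history = "(nat \<Rightarrow> 'x \<times> 'u) \<times> 'x"

type_synonym ('x, 'u) policy = "nat \<Rightarrow> ('x, 'u) history \<Rightarrow> 'u measure"

definition path_algebra :: "('x, 'u) mp \<Rightarrow> ('x, 'u) path measure" where
  "path_algebra D = (\<Pi>\<^sub>M i\<in>UNIV. state_algebra D \<Otimes>\<^sub>M action_algebra D)"

definition history_algebra :: "('x, 'u) mp \<Rightarrow> nat \<Rightarrow> ('x, 'u) history measure" where
  "history_algebra D n =
     (\<Pi>\<^sub>M i\<in>{..<n}. state_algebra D \<Otimes>\<^sub>M action_algebra D) \<Otimes>\<^sub>M state_algebra D"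

definition state_at :: "('x, 'u) path \<Rightarrow> nat \<Rightarrow> 'x" where
  "state_at \<omega> k = fst (\<omega> k)"

definition action_at :: "('x, 'u) path \<Rightarrow> nat \<Rightarrow> 'u" where
  "action_at \<omega> k = snd (\<omega> k)"

definition history_of :: "('x, 'u) path \<Rightarrow> nat \<Rightarrow> ('x, 'u) history" where
  "history_of \<omega> n = (restrict \<omega> {..<n}, state_at \<omega> n)"

(* The sections of an analytic set need not be Borel, hence the completion. *)
definition policies :: "('x, 'u) mp \<Rightarrow> ('x, 'u) policy set" where
  "policies D = {\<pi>. \<forall>n.
     \<pi> n \<in> univ_completion (history_algebra D n) \<rightarrow>\<^sub>M prob_algebra (action_algebra D) \<and>
     (\<forall>h \<in> space (history_algebra D n).
        emeasure (completion (\<pi> n h)) (admissible_actions D (snd h)) = 1)}"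

(* The policy kernels are only universally measurable, so the defining identity for the
   conditional law of u_n integrates over the completion of P. *)
definition is_path_law ::
    "('x, 'u) mp \<Rightarrow> ('x, 'u) policy \<Rightarrow> 'x \<Rightarrow> ('x, 'u) path measure \<Rightarrow> bool" where
  "is_path_law D \<pi> x P \<longleftrightarrow>
     P \<in> space (prob_algebra (path_algebra D)) \<and>
     (AE \<omega> in P. state_at \<omega> 0 = x) \<and>
     (\<forall>n. \<forall>A \<in> sets (history_algebra D n). \<forall>B \<in> sets (action_algebra D).
        emeasure P {\<omega> \<in> space P. history_of \<omega> n \<in> A \<and> action_at \<omega> n \<in> B} =
        (\<integral>\<^sup>+\<omega>. indicator A (history_of \<omega> n) * emeasure (\<pi> n (history_of \<omega> n)) B \<partial>completion P)) \<and>
     (\<forall>n. \<forall>A \<in> sets (history_algebra D n \<Otimes>\<^sub>M action_algebra D). \<forall>B \<in> sets (state_algebra D).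
        emeasure P {\<omega> \<in> space P.
            (history_of \<omega> n, action_at \<omega> n) \<in> A \<and> state_at \<omega> (Suc n) \<in> B} =
        (\<integral>\<^sup>+\<omega>. indicator A (history_of \<omega> n, action_at \<omega> n) *
                emeasure (kernel D (state_at \<omega> n, action_at \<omega> n)) B \<partial>P))"

definition path_law ::
    "('x, 'u) mp \<Rightarrow> ('x, 'u) policy \<Rightarrow> 'x \<Rightarrow> ('x, 'u) path measure" where
  "path_law D \<pi> x = (THE P. is_path_law D \<pi> x P)"

definition policy_value ::
    "('x, 'u) mp \<Rightarrow> ('x, 'u) policy \<Rightarrow> 'x \<Rightarrow> (('x, 'u) path \<Rightarrow> ennreal) \<Rightarrow> ennreal" where
  "policy_value D \<pi> x J = (\<integral>\<^sup>+\<omega>. J \<omega> \<partial>path_law D \<pi> x)"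

definition sup_value ::
    "('x, 'u) mp \<Rightarrow> 'x \<Rightarrow> (('x, 'u) path \<Rightarrow> ennreal) \<Rightarrow> ennreal" where
  "sup_value D x J = (SUP \<pi>\<in>policies D. policy_value D \<pi> x J)"

definition inf_value ::
    "('x, 'u) mp \<Rightarrow> 'x \<Rightarrow> (('x, 'u) path \<Rightarrow> ennreal) \<Rightarrow> ennreal" where
  "inf_value D x J = (INF \<pi>\<in>policies D. policy_value D \<pi> x J)"

definition until_event ::
    "('x, 'u) mp \<Rightarrow> 'x set \<Rightarrow> enat \<Rightarrow> 'x set \<Rightarrow> ('x, 'u) path set" where
  "until_event D S n G =
     {\<omega> \<in> space (path_algebra D).
        \<exists>i. enat i \<le> n \<and> state_at \<omega> i \<in> G \<and> (\<forall>j<i. state_at \<omega> j \<in> S)}"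

datatype mode = QS | QF

fun mode_step :: "'x set \<Rightarrow> mode \<Rightarrow> 'x \<Rightarrow> mode" where
  "mode_step S QS x = (if x \<in> S then QS else QF)"
| "mode_step S QF x = QF"

(* The kernel is the product of T(. | x, u) with the point mass at the next mode, i.e. the unique
   measure taking the value 1_B(t(q, x)) T(A | x, u) on each rectangle A x B. *)
definition aux_MP :: "('x, 'u) mp \<Rightarrow> 'x set \<Rightarrow> ('x \<times> mode, 'u) mp" where
  "aux_MP D S =
     \<lparr> states = prod_topology (states D) (discrete_topology UNIV),
       actions = actions D,
       admissible = {((x, q), u) | x q u. (x, u) \<in> admissible D},
       kernel = (\<lambda>((x, q), u).
         kernel D (x, u) \<Otimes>\<^sub>M return (borel_of (discrete_topology UNIV)) (mode_step S q x)) \<rparr>"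

fun stage_cost :: "'x set \<Rightarrow> 'x \<times> mode \<Rightarrow> ennreal" where
  "stage_cost G (x, q) = (if q = QS then 1 else 0) * indicator G x"

definition total_cost :: "'x set \<Rightarrow> enat \<Rightarrow> ('x \<times> mode, 'u) path \<Rightarrow> ennreal" where
  "total_cost G n \<omega> =
     (case n of
        enat m \<Rightarrow> \<Sum>k=0..m. stage_cost G (state_at \<omega> k)
      | \<infinity> \<Rightarrow> \<Sum>k. stage_cost G (state_at \<omega> k))"

end

theory Submission
  imports Defs
begin

text \<open>
Along a path of the auxiliary process the mode is a deterministic function of the initial mode and
of the states visited so far. Starting in mode \<open>q\<close>, a path of \<open>D\<close> therefore has exactly one lift
(\<open>lift_path\<close>), a history has exactly one lift (\<open>lift_history\<close>), and forgetting the modes undoes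
the lift. Composing policies with these two maps turns policies of either process into policies of
the other, and the law of the auxiliary process started in \<open>(x, q)\<close> is the image of the law of \<open>D\<close>
started in \<open>x\<close> under \<open>lift_path\<close> (\<open>is_path_law_lift\<close>). So the two processes realise the same set
of values: a cost \<open>J\<close> in the auxiliary process has the same supremum and infimum as the cost
\<open>J \<circ> lift_path\<close> in \<open>D\<close> (\<open>values_lift\<close>).

It remains to compute the lift of the total cost. From \<open>QF\<close> the mode never returns to \<open>QS\<close>, so the
cost vanishes. From \<open>QS\<close> the mode at time \<open>k\<close> is \<open>QS\<close> exactly if all earlier states lie in \<open>S\<close>, so
the cost counts the times \<open>k\<close> at which \<open>G\<close> is reached through \<open>S\<close>. As \<open>S\<close> and \<open>G\<close> are disjoint
there is at most one such time, and the cost is the indicator of the until event.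

The identification of laws rests on the fact that \<open>path_law\<close> is the only measure with the defining
identities, and that such a measure exists. Existence (\<open>path_law_exists\<close>) is the
Ionescu-Tulcea theorem, but policies are only universally measurable. Along the construction each
\<open>\<pi> n\<close> is replaced by a Borel kernel that agrees with it almost surely for the law of the history at
time \<open>n\<close>, which is already determined at that point. Uniqueness (\<open>path_law_unique\<close>) is an induction
on the length of the history.

That the infimum from \<open>QF\<close> is \<open>0\<close>, and not the infimum of the empty set, needs a policy. It comes
from the Jankov-von Neumann selection theorem (\<open>analytic_univ_measurable_selector\<close>), which in turn
uses Luzin's theorem that analytic sets are universally measurable
(\<open>continuous_image_of_closed_in_completion\<close>).
\<close>

section \<open>Borel sets of metrizable second countable spaces\<close>

lemma space_borel_of [simp]: "space (borel_of X) = topspace X"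
  unfolding borel_of_def by (rule space_measure_of) (auto dest: openin_subset)

lemma sets_borel_of: "sets (borel_of X) = sigma_sets (topspace X) {V. openin X V}"
  unfolding borel_of_def by (rule sets_measure_of) (auto dest: openin_subset)

lemma openin_sets_borel_of: "openin X V \<Longrightarrow> V \<in> sets (borel_of X)"
  unfolding sets_borel_of by auto

lemma closedin_sets_borel_of:
  assumes "closedin X C" shows "C \<in> sets (borel_of X)"
proof -
  have "topspace X - (topspace X - C) \<in> sets (borel_of X)"
    using openin_sets_borel_of[of X "topspace X - C"] sets.compl_sets[of "topspace X -
        C" "borel_of X"] assms by (auto simp: closedin_def)
  then show ?thesis using closedin_subset[OF assms] by (simp add: double_diff)
qed

lemma measurable_borel_ofI:
  assumes "f \<in> space M \<rightarrow> topspace X" "\<And>V. openin X V \<Longrightarrow> f -` V \<inter> space M \<in> sets M"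
  shows "f \<in> M \<rightarrow>\<^sub>M borel_of X"
  unfolding borel_of_def
  by (rule measurable_measure_of) (use assms in \<open>auto dest: openin_subset\<close>)

text \<open>
The balls of radius \<open>1 / (k + 1)\<close> around the points of a countable dense set form a base.
\<close>

lemma metrizable_separable_imp_second_countable:
  assumes "metrizable_space X" "separable_space X"
  shows "second_countable X"
proof -
  obtain M d where ms: "Metric_space M d" and X: "X = Metric_space.mtopology M d"
    using assms(1) unfolding metrizable_space_def by blast
  interpret Metric_space M d by fact
  obtain C where C: "countable C" "C \<subseteq> M" "mtopology closure_of C = M"
    using assms(2) unfolding separable_space_def X by auto
  let ?B = "(\<lambda>(c, k). mball c (inverse (Suc k))) ` (C \<times> (UNIV :: nat set))"
  have "\<exists>V\<in>?B. x \<in> V \<and> V \<subseteq> U" if U: "openin mtopology U" and x: "x \<in> U" for U x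
  proof -
    obtain r where r: "0 < r" "mball x r \<subseteq> U" and xM: "x \<in> M"
      using U x unfolding openin_mtopology by blast
    obtain k where k: "inverse (Suc k) < r / 2"
      using reals_Archimedean[of "r / 2"] r by auto
    have "x \<in> mtopology closure_of C" using C xM by simp
    then obtain c where c: "c \<in> C" "c \<in> mball x (inverse (Suc k))"
      unfolding metric_closure_of by (smt (verit, best) inverse_positive_iff_positive
        mem_Collect_eq of_nat_0_less_iff zero_less_Suc)
    have "mball c (inverse (Suc k)) \<subseteq> U"
    proof -
      have "mball c (inverse (Suc k)) \<subseteq> mball x r"
      proof
        fix y assume y: "y \<in> mball c (inverse (Suc k))"
        then have "d x y \<le> d x c + d c y" using c xM by (intro triangle) (auto simp: in_mball)
        also have "\<dots> < r" using y c k by (auto simp: in_mball)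
        finally show "y \<in> mball x r" using y xM by (auto simp: in_mball)
      qed
      with r show ?thesis by blast
    qed
    moreover have "x \<in> mball c (inverse (Suc k))" using c by (auto simp: in_mball commute)
    ultimately show ?thesis using c by (intro bexI[of _ "mball c (inverse (Suc k))"]) auto
  qed
  then show ?thesis
    unfolding second_countable_def X using C(1)
    by (intro exI[of _ ?B]) (auto intro!: countable_image)
qed

lemma borel_space_imp_metrizable_second_countable:
  assumes "borel_space X"
  shows "metrizable_space X" and "second_countable X"
proof -
  obtain Y :: "real topology" and B where Y: "completely_metrizable_space Y" "separable_space Y"
    and h: "X homeomorphic_space subtopology Y B"
    using assms unfolding borel_space_def by blast
  have mY: "metrizable_space Y" using Y(1) by (rule completely_metrizable_imp_metrizable_space)
  show "metrizable_space X"
    using homeomorphic_metrizable_space[OF h] metrizable_space_subtopology[OF mY] by blast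
  show "second_countable X"
    using homeomorphic_space_second_countability[OF h] second_countable_subtopology
      metrizable_separable_imp_second_countable[OF mY Y(2)] by blast
qed

lemma singleton_sets_borel_of:
  assumes "metrizable_space X" "x \<in> topspace X"
  shows "{x} \<in> sets (borel_of X)"
  using assms by (intro closedin_sets_borel_of)
    (auto intro!: closedin_t1_singleton metrizable_imp_t1_space)

text \<open>
Finite intersections of basic open sets. A probability measure is determined by its values on such a
family, so statements about kernels reduce to countably many real functions.
\<close>

lemma second_countable_imp_countable_generator:
  assumes "second_countable X"
  obtains G where "countable G" "Int_stable G" "G \<subseteq> Pow (topspace X)"
    "sets (borel_of X) = sigma_sets (topspace X) G"
proof -
  obtain B where B: "countable B" "\<And>V. V \<in> B \<Longrightarrow> openin X V"
    "\<And>U x. openin X U \<Longrightarrow> x \<in> U \<Longrightarrow> \<exists>V\<in>B. x \<in> V \<and> V \<subseteq> U"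
    using assms unfolding second_countable_def by metis
  define G where "G = (\<lambda>F. topspace X \<inter> \<Inter>F) ` {F. finite F \<and> F \<subseteq> B}"
  have BG: "V \<in> G" if "V \<in> B" for V
    using B(2)[OF that] openin_subset that unfolding G_def
    by (intro image_eqI[of _ _ "{V}"]) auto
  have oG: "openin X V" if V: "V \<in> G" for V
  proof -
    obtain F where F: "finite F" "F \<subseteq> B" "V = topspace X \<inter> \<Inter>F"
      using V unfolding G_def by blast
    have "openin X (topspace X \<inter> \<Inter>F)"
      using F(1,2) B(2) by (intro openin_Int_Inter) (auto dest: subsetD)
    then show ?thesis using F by simp
  qed
  have "Int_stable G"
  proof (rule Int_stableI)
    fix a b assume "a \<in> G" "b \<in> G"
    then obtain F F' where "finite F" "F \<subseteq> B" "a = topspace X \<inter> \<Inter>F" "finite F'" "F' \<subseteq> B"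
      "b = topspace X \<inter> \<Inter>F'"
      unfolding G_def by blast
    then show "a \<inter> b \<in> G" unfolding G_def by (intro image_eqI[of _ _ "F \<union> F'"]) auto
  qed
  moreover have "countable G"
    unfolding G_def using countable_Collect_finite_subset[OF B(1)] by (rule countable_image)
  moreover have sub: "G \<subseteq> Pow (topspace X)" using oG openin_subset by blast
  moreover have "sets (borel_of X) = sigma_sets (topspace X) G"
  proof
    show "sigma_sets (topspace X) G \<subseteq> sets (borel_of X)"
      unfolding sets_borel_of using oG by (intro sigma_sets_mono') auto
    have "V \<in> sigma_sets (topspace X) G" if V: "openin X V" for V
    proof -
      have "V = \<Union>{W \<in> B. W \<subseteq> V}" using B(3)[OF V] by blast
      moreover have "\<Union>{W \<in> B. W \<subseteq> V} \<in> sigma_sets (topspace X) G"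
        using BG B(1) sub by (intro sigma_sets_UNION) (auto intro: countable_subset[OF _ B(1)])
      ultimately show ?thesis by simp
    qed
    then show "sets (borel_of X) \<subseteq> sigma_sets (topspace X) G"
      unfolding sets_borel_of by (intro sigma_sets_mono) auto
  qed
  ultimately show thesis using that by blast
qed

section \<open>Universal measurability\<close>

lemma space_univ_completion [simp]: "space (univ_completion M) = space M"
  unfolding univ_completion_def by (rule space_measure_of) auto

text \<open>
The completions of all probability measures are sigma-algebras, and so is their intersection: the
generated sigma-algebra adds nothing.
\<close>

lemma sets_univ_completion:
  "sets (univ_completion M) =
     {A. A \<subseteq> space M \<and> (\<forall>p \<in> space (prob_algebra M). A \<in> sets (completion p))}" (is "_ = ?S")
proof -
  have sp: "space p = space M" if "p \<in> space (prob_algebra M)" for p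
    using that by (auto simp: space_prob_algebra dest: sets_eq_imp_space_eq)
  have "sigma_algebra (space M) ?S"
    unfolding sigma_algebra_iff2
  proof (intro conjI ballI allI impI)
    fix A assume A: "A \<in> ?S"
    then have "space M - A \<in> sets (completion p)" if "p \<in> space (prob_algebra M)" for p
      using sets.compl_sets[of A "completion p"] that sp[OF that] by auto
    then show "space M - A \<in> ?S" by auto
  qed auto
  then show ?thesis
    unfolding univ_completion_def by (simp add: sigma_algebra.sets_measure_of_eq)
qed

lemma sets_univ_completionI: "A \<in> sets M \<Longrightarrow> A \<in> sets (univ_completion M)"
  unfolding sets_univ_completion
  by (auto simp: space_prob_algebra dest: sets.sets_into_space)

lemma measurable_univ_completion_imp_completion:
  assumes "f \<in> univ_completion M \<rightarrow>\<^sub>M N" and p: "p \<in> space (prob_algebra M)"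
  shows "f \<in> completion p \<rightarrow>\<^sub>M N"
proof -
  have "space p = space M"
    using p by (auto simp: space_prob_algebra dest: sets_eq_imp_space_eq)
  then show ?thesis using assms unfolding measurable_def sets_univ_completion by auto
qed

lemma measurable_completion_distr:
  assumes "f \<in> M \<rightarrow>\<^sub>M N"
  shows "f \<in> completion M \<rightarrow>\<^sub>M completion (distr M N f)"
  using completion.measurable_completion2[where M=M and f=f and N="distr M N f"] assms
  by (auto simp: distr_completion measurable_completion cong: distr_cong)

text \<open>
Null sets of an image measure pull back to null sets, so the preimage of a set that is measurable for
the completion of \<open>distr p N f\<close> is measurable for the completion of \<open>p\<close>.
\<close>

lemma measurable_univ_completion:
  assumes f: "f \<in> M \<rightarrow>\<^sub>M N"
  shows "f \<in> univ_completion M \<rightarrow>\<^sub>M univ_completion N"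
proof (rule measurableI)
  show "f x \<in> space (univ_completion N)" if "x \<in> space (univ_completion M)" for x
    using that measurable_space[OF f] by simp
  fix A assume A: "A \<in> sets (univ_completion N)"
  have "f -` A \<inter> space M \<in> sets (completion p)" if p: "p \<in> space (prob_algebra M)" for p
  proof -
    have sp: "sets p = sets M" and "prob_space p" using p by (auto simp: space_prob_algebra)
    then have fp: "f \<in> p \<rightarrow>\<^sub>M N" using f by (simp cong: measurable_cong_sets)
    then have "distr p N f \<in> space (prob_algebra N)"
      using \<open>prob_space p\<close> by (auto simp: space_prob_algebra intro: prob_space.prob_space_distr)
    then have "A \<in> sets (completion (distr p N f))" using A by (auto simp: sets_univ_completion)
    then show ?thesis
      using measurable_sets[OF measurable_completion_distr[OF fp], of A]
        sets_eq_imp_space_eq[OF sp] by simp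
  qed
  then show "f -` A \<inter> space (univ_completion M) \<in> sets (univ_completion M)"
    unfolding sets_univ_completion by auto
qed

lemma completion_countable_version:
  assumes "countable I" "\<And>i. i \<in> I \<Longrightarrow> (f i :: 'a \<Rightarrow> ennreal) \<in> borel_measurable (completion M)"
  obtains N where "N \<in> null_sets M"
    "\<And>i. i \<in> I \<Longrightarrow> \<exists>g\<in>borel_measurable M. \<forall>x\<in>space M - N. f i x = g x"
proof -
  have "\<forall>i\<in>I. \<exists>g\<in>borel_measurable M. AE x in M. f i x = g x"
    using completion_ex_borel_measurable assms by blast
  then obtain g where g: "\<And>i. i \<in> I \<Longrightarrow> g i \<in> borel_measurable M"
    "\<And>i. i \<in> I \<Longrightarrow> AE x in M. f i x = g i x"
    by metis
  have "AE x in M. \<forall>i\<in>I. f i x = g i x"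
    using g assms by (simp add: AE_ball_countable)
  then obtain N where "N \<in> null_sets M" "{x\<in>space M. \<not> (\<forall>i\<in>I. f i x = g i x)} \<subseteq> N"
    unfolding eventually_ae_filter by auto
  then show thesis using g by (intro that[of N]) blast+
qed

text \<open>
For each set of a countable generator, the mass that \<open>K\<close> gives to it is almost surely equal to a
Borel function. Off a single null set all these functions agree with \<open>K\<close>; on that set \<open>K\<close> is
replaced by a constant.
\<close>

lemma kernel_borel_version:
  assumes p: "p \<in> space (prob_algebra H)" and K: "K \<in> univ_completion H \<rightarrow>\<^sub>M prob_algebra L"
    and G: "countable G" "Int_stable G" "G \<subseteq> Pow (space L)" "sets L = sigma_sets (space L) G"
  obtains K' where "K' \<in> H \<rightarrow>\<^sub>M prob_algebra L" "AE h in p. K' h = K h"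
proof -
  have sp: "sets p = sets H" and pp: "prob_space p" using p by (auto simp: space_prob_algebra)
  have spp: "space p = space H" using sp by (rule sets_eq_imp_space_eq)
  have Kp: "K \<in> completion p \<rightarrow>\<^sub>M prob_algebra L"
    by (rule measurable_univ_completion_imp_completion[OF K p])
  have Kspace: "K h \<in> space (prob_algebra L)" if "h \<in> space H" for h
    using measurable_space[OF K, of h] that by simp
  have "(\<lambda>h. emeasure (K h) A) \<in> borel_measurable (completion p)" if "A \<in> G" for A
    using that G by (intro measurable_emeasure_kernel[OF measurable_prob_algebraD[OF Kp]]) auto
  then obtain N where N: "N \<in> null_sets p" and
    g: "\<And>A. A \<in> G \<Longrightarrow> \<exists>g\<in>borel_measurable p. \<forall>h\<in>space p - N. emeasure (K h) A = g h"
    using completion_countable_version[OF G(1), of "\<lambda>A h. emeasure (K h) A" p] by metis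
  obtain h0 where h0: "h0 \<in> space H"
    using prob_space.not_empty[OF pp] spp by auto
  \<comment> \<open>The value \<open>K h0\<close> only serves to be some probability measure.\<close>
  define K' where "K' h = (if h \<in> N then K h0 else K h)" for h
  have NH: "N \<in> sets H" using N sp by auto
  have K'space: "K' h \<in> space (prob_algebra L)" if "h \<in> space H" for h
    using Kspace that h0 by (auto simp: K'_def)
  have "K' \<in> H \<rightarrow>\<^sub>M prob_algebra L"
  proof (rule measurable_prob_algebra_generated[OF G(4,2,3)])
    fix A assume A: "A \<in> G"
    then obtain g where "g \<in> borel_measurable p"
      and gA: "\<And>h. h \<in> space p - N \<Longrightarrow> emeasure (K h) A = g h"
      using g by blast
    then have [measurable]: "g \<in> borel_measurable H" using sp by (simp cong: measurable_cong_sets)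
    have "(\<lambda>h. if h \<in> N then emeasure (K h0) A else g h) \<in> borel_measurable H"
      using NH by measurable
    also have "?this \<longleftrightarrow> (\<lambda>h. emeasure (K' h) A) \<in> borel_measurable H"
      using gA spp by (intro measurable_cong) (auto simp: K'_def)
    finally show "(\<lambda>h. emeasure (K' h) A) \<in> borel_measurable H" .
  qed (use K'space in \<open>auto simp: space_prob_algebra\<close>)
  moreover have "AE h in p. K' h = K h"
    using AE_not_in[OF N] by eventually_elim (simp add: K'_def)
  ultimately show thesis by (rule that)
qed

section \<open>Luzin: analytic sets are universally measurable\<close>

definition cylinder :: "nat list \<Rightarrow> (nat \<Rightarrow> nat) set" where
  "cylinder s = {\<alpha>. \<forall>i<length s. \<alpha> i = s ! i}"

lemma mem_cylinder_iff: "\<beta> \<in> cylinder s \<longleftrightarrow> (\<forall>i<length s. \<beta> i = s ! i)"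
  by (simp add: cylinder_def)

lemma mem_cylinder_prefix: "\<beta> \<in> cylinder (map \<alpha> [0..<n]) \<longleftrightarrow> (\<forall>i<n. \<beta> i = \<alpha> i)"
  by (simp add: mem_cylinder_iff)

lemma cylinder_Nil [simp]: "cylinder [] = UNIV"
  by (simp add: cylinder_def)

lemma cylinder_snoc: "\<beta> \<in> cylinder (s @ [m]) \<longleftrightarrow> \<beta> \<in> cylinder s \<and> \<beta> (length s) = m"
  by (auto simp: cylinder_def nth_append less_Suc_eq)

lemma closed_cylinder: "closed (cylinder s)"
  and open_cylinder: "open (cylinder s)"
proof -
  have c: "continuous_on UNIV (\<lambda>\<alpha>::nat \<Rightarrow> nat. \<alpha> i)" for i
    by (rule continuous_on_product_coordinates)
  have eq: "cylinder s = (\<Inter>i\<in>{..<length s}. (\<lambda>\<alpha>. \<alpha> i) -` {s ! i})"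
    by (auto simp: mem_cylinder_iff)
  show "closed (cylinder s)" unfolding eq
    by (intro closed_INT ballI closed_vimage c) simp
  show "open (cylinder s)" unfolding eq
    by (intro open_INT ballI open_vimage c) (auto simp: discrete_topology_class.open_discrete)
qed

lemma open_contains_cylinder:
  fixes W :: "(nat \<Rightarrow> nat) set"
  assumes "open W" "\<alpha> \<in> W"
  shows "\<exists>n. cylinder (map \<alpha> [0..<n]) \<subseteq> W"
proof -
  have "openin (product_topology (\<lambda>i. euclidean) UNIV) W"
    using assms by (simp add: euclidean_product_topology)
  then obtain B where B: "\<alpha> \<in> Pi\<^sub>E UNIV B" "finite {i. B i \<noteq> UNIV}" "Pi\<^sub>E UNIV B \<subseteq> W"
    using product_topology_open_contains_basis[of "\<lambda>i. euclidean" UNIV W \<alpha>] assms(2) by auto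
  obtain n where n: "\<And>i. B i \<noteq> UNIV \<Longrightarrow> i < n"
    using B(2) unfolding finite_nat_set_iff_bounded by blast
  have "cylinder (map \<alpha> [0..<n]) \<subseteq> Pi\<^sub>E UNIV B"
    unfolding mem_cylinder_prefix subset_iff
  proof (intro allI impI)
    fix \<beta> assume "\<forall>i<n. \<beta> i = \<alpha> i"
    then have "\<beta> i \<in> B i" for i
      using B(1) n[of i] by (cases "B i = UNIV") (auto simp: PiE_iff)
    then show "\<beta> \<in> Pi\<^sub>E UNIV B" by auto
  qed
  with B(3) show ?thesis by blast
qed

lemma compact_bounded_sequences: "compact {\<alpha> :: nat \<Rightarrow> nat. \<forall>i. \<alpha> i \<le> k i}"
proof -
  have "compactin (product_topology (\<lambda>i. euclidean) UNIV) (Pi\<^sub>E UNIV (\<lambda>i. {..k i}))"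
    unfolding compactin_PiE by (simp add: finite_imp_compact)
  moreover have "Pi\<^sub>E UNIV (\<lambda>i. {..k i}) = {\<alpha> :: nat \<Rightarrow> nat. \<forall>i. \<alpha> i \<le> k i}"
    by (auto simp: PiE_iff)
  ultimately show ?thesis by (simp add: euclidean_product_topology)
qed

text \<open>
The sequences bounded by \<open>k\<close> form a compact set, so finitely many cylinders inside \<open>W \<union> - F\<close> cover it.
If \<open>n\<close> is at least the length of these cylinders, only the first \<open>n\<close> entries of a sequence decide
whether it lies in their union.
\<close>

lemma bounded_prefix_subset_open:
  fixes F W :: "(nat \<Rightarrow> nat) set"
  assumes F: "closed F" and W: "open W"
    and sub: "{\<alpha> \<in> F. \<forall>i. \<alpha> i \<le> k i} \<subseteq> W"
  shows "\<exists>n. {\<alpha> \<in> F. \<forall>i<n. \<alpha> i \<le> k i} \<subseteq> W"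
proof -
  let ?K = "{\<alpha> :: nat \<Rightarrow> nat. \<forall>i. \<alpha> i \<le> k i}"
  have "\<exists>n. cylinder (map \<alpha> [0..<n]) \<subseteq> W \<union> - F" if "\<alpha> \<in> ?K" for \<alpha>
    using that sub F W by (intro open_contains_cylinder) auto
  then obtain len where len: "\<And>\<alpha>. \<alpha> \<in> ?K \<Longrightarrow> cylinder (map \<alpha> [0..<len \<alpha>]) \<subseteq> W \<union> - F"
    by metis
  have "?K \<subseteq> (\<Union>\<alpha>\<in>?K. cylinder (map \<alpha> [0..<len \<alpha>]))"
    by (auto simp: mem_cylinder_prefix)
  then obtain T where T: "T \<subseteq> ?K" "finite T" "?K \<subseteq> (\<Union>\<alpha>\<in>T. cylinder (map \<alpha> [0..<len \<alpha>]))"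
    by (rule compactE_image[OF compact_bounded_sequences[of k] open_cylinder])
  obtain n where n: "\<And>\<alpha>. \<alpha> \<in> T \<Longrightarrow> len \<alpha> \<le> n"
    using finite_nat_set_iff_bounded_le[of "len ` T"] T(2) by auto
  have "\<beta> \<in> W" if \<beta>: "\<beta> \<in> F" "\<forall>i<n. \<beta> i \<le> k i" for \<beta>
  proof -
    \<comment> \<open>Truncating \<open>\<beta>\<close> by \<open>k\<close> gives a bounded sequence with the same first \<open>n\<close> entries.\<close>
    have "(\<lambda>i. min (\<beta> i) (k i)) \<in> ?K" by auto
    then obtain \<alpha> where \<alpha>: "\<alpha> \<in> T" "(\<lambda>i. min (\<beta> i) (k i)) \<in> cylinder (map \<alpha> [0..<len \<alpha>])"
      by (rule UN_E[OF subsetD[OF T(3)]])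
    have "\<beta> \<in> cylinder (map \<alpha> [0..<len \<alpha>])"
      unfolding mem_cylinder_prefix
    proof (intro allI impI)
      fix i assume i: "i < len \<alpha>"
      with n[OF \<alpha>(1)] \<beta>(2) have "min (\<beta> i) (k i) = \<beta> i" by (simp add: min_def)
      with i \<alpha>(2) show "\<beta> i = \<alpha> i" unfolding mem_cylinder_prefix by metis
    qed
    then show ?thesis using len[of \<alpha>] \<alpha>(1) T(1) \<beta>(1) by blast
  qed
  then show ?thesis by blast
qed

text \<open>
The union of a maximising sequence of measurable subsets has the same mass as a measurable hull of
\<open>A\<close>, so \<open>A\<close> lies between two measurable sets that differ by a null set.
\<close>

lemma inner_approx_imp_completion:
  fixes p :: "'a measure"
  assumes "finite_measure p" "A \<subseteq> space p"
    and inner: "\<And>c. c < outer_measure_of p A \<Longrightarrow> \<exists>B\<in>sets p. B \<subseteq> A \<and> c \<le> emeasure p B"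
  shows "A \<in> sets (completion p)"
proof -
  interpret finite_measure p by fact
  obtain E where E: "E \<in> sets p" "A \<subseteq> E" "outer_measure_of p A = emeasure p E"
    using outer_measure_of_attain[OF assms(2)] by blast
  let ?\<B> = "{B\<in>sets p. B \<subseteq> A}"
  obtain b :: "nat \<Rightarrow> ennreal" where b: "range b \<subseteq> emeasure p ` ?\<B>"
    "Sup (emeasure p ` ?\<B>) = (SUP i. b i)"
    using ennreal_Sup_countable_SUP[of "emeasure p ` ?\<B>"] by blast
  then have "\<forall>i. \<exists>B\<in>?\<B>. b i = emeasure p B" by blast
  then obtain B where B: "\<And>i. B i \<in> sets p" "\<And>i. B i \<subseteq> A" "\<And>i. b i = emeasure p (B i)"
    by (metis (no_types, lifting) mem_Collect_eq)
  let ?S = "\<Union>i. B i"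
  have S: "?S \<in> sets p" "?S \<subseteq> A" using B by auto
  have "emeasure p E \<le> (SUP B\<in>?\<B>. emeasure p B)"
  proof (rule dense_le)
    fix c assume "c < emeasure p E"
    then show "c \<le> (SUP B\<in>?\<B>. emeasure p B)"
      using inner[of c] E(3) by (auto intro: SUP_upper2)
  qed
  also have "\<dots> \<le> emeasure p ?S"
    unfolding b(2) B(3) using B(1) by (intro SUP_least emeasure_mono) auto
  finally have "emeasure p (E - ?S) = 0"
    using emeasure_Diff[of p ?S E] S E by (auto simp: diff_eq_0_iff_ennreal less_top[symmetric])
  then have "E - ?S \<in> null_sets p" using E S by (auto intro: null_setsI)
  then show ?thesis
    using S E by (intro sets_completionI[of A ?S "A - ?S" "E - ?S"]) auto
qed

text \<open>
Luzin's theorem. Restricting the first entries of the sequences in \<open>F\<close> one after another to finite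
ranges \<open>{..k n}\<close> loses arbitrarily little outer measure, because outer measure is continuous along
increasing sequences of arbitrary sets. What is left in the limit is a compact set of sequences. Its
image is compact, hence closed and a decreasing intersection of open sets. Each of these open sets
contains the image of some finite stage, so the image has at least the outer measure retained at
every finite stage.
\<close>

theorem continuous_image_of_closed_in_completion:
  fixes g :: "(nat \<Rightarrow> nat) \<Rightarrow> 'a"
  assumes X: "metrizable_space X" and g: "continuous_map euclidean X g" and F: "closed F"
    and p: "finite_measure p" "sets p = sets (borel_of X)"
  shows "g ` F \<in> sets (completion p)"
proof (rule inner_approx_imp_completion[OF p(1)])
  interpret finite_measure p by fact
  have sp: "space p = topspace X" using sets_eq_imp_space_eq[OF p(2)] by simp
  have gX: "g \<alpha> \<in> topspace X" for \<alpha> using continuous_map_image_subset_topspace[OF g] by auto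
  then show "g ` F \<subseteq> space p" using sp by auto
  fix c assume c: "c < outer_measure_of p (g ` F)"
  have "\<exists>E. \<forall>n. (c < outer_measure_of p (g ` E n) \<and> (n = 0 \<longrightarrow> E n = F)) \<and>
      (\<exists>m. E (Suc n) = {\<alpha> \<in> E n. \<alpha> n \<le> m})"
  proof (rule dependent_nat_choice)
    show "\<exists>E. c < outer_measure_of p (g ` E) \<and> ((0::nat) = 0 \<longrightarrow> E = F)" using c by auto
  next
    fix E and n :: nat
    assume E: "c < outer_measure_of p (g ` E) \<and> (n = 0 \<longrightarrow> E = F)"
    have "(SUP m. outer_measure_of p (g ` {\<alpha> \<in> E. \<alpha> n \<le> m})) = outer_measure_of p (\<Union>m. g ` {\<alpha> \<in>
        E. \<alpha> n \<le> m})"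
      using gX sp by (intro SUP_outer_measure_of_incseq) (auto simp: incseq_def)
    also have "(\<Union>m. g ` {\<alpha> \<in> E. \<alpha> n \<le> m}) = g ` E" by auto
    finally have "c < (SUP m. outer_measure_of p (g ` {\<alpha> \<in> E. \<alpha> n \<le> m}))" using E by simp
    then obtain m where "c < outer_measure_of p (g ` {\<alpha> \<in> E. \<alpha> n \<le> m})"
      unfolding less_SUP_iff by blast
    then show "\<exists>E'. (c < outer_measure_of p (g ` E') \<and> (Suc n = 0 \<longrightarrow> E' = F)) \<and> (\<exists>m. E' = {\<alpha> \<in>
        E. \<alpha> n \<le> m})"
      by auto
  qed
  then obtain E where E: "\<And>n. c < outer_measure_of p (g ` E n)" "E 0 = F"
      and "\<forall>n. \<exists>m. E (Suc n) = {\<alpha> \<in> E n. \<alpha> n \<le> m}" by blast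
  then obtain k where k: "\<And>n. E (Suc n) = {\<alpha> \<in> E n. \<alpha> n \<le> k n}"
    by (auto dest: choice)
  have En: "E n = {\<alpha> \<in> F. \<forall>i<n. \<alpha> i \<le> k i}" for n
    by (induction n) (auto simp: E(2) k less_Suc_eq)
  let ?K = "{\<alpha> \<in> F. \<forall>i. \<alpha> i \<le> k i}"
  have "compact (F \<inter> {\<alpha>. \<forall>i. \<alpha> i \<le> k i})"
    by (rule closed_Int_compact[OF F compact_bounded_sequences])
  also have "F \<inter> {\<alpha>. \<forall>i. \<alpha> i \<le> k i} = ?K" by auto
  finally have "compactin X (g ` ?K)"
    by (intro image_compactin[OF _ g]) simp
  then have "closedin X (g ` ?K)"
    using X by (intro compactin_imp_closedin metrizable_imp_Hausdorff_space)
  then obtain V where V: "\<And>n. openin X (V n)" "\<And>n. V (Suc n) \<subseteq> V n" "\<Inter>(range V) = g ` ?K"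
    using closed_imp_gdelta_in[OF X, of "g ` ?K"] unfolding gdelta_in_descending[of X "g ` ?K"]
      by auto
  have Vp: "V n \<in> sets p" for n using openin_sets_borel_of[OF V(1)] p by simp
  have "c \<le> emeasure p (V n)" for n
  proof -
    have W: "open (g -` V n)"
      using openin_continuous_map_preimage[OF g V(1)[of n]] by (simp add: vimage_def)
    have "?K \<subseteq> g -` V n" using V(3) by blast
    from bounded_prefix_subset_open[OF F W this]
    obtain l where "E l \<subseteq> g -` V n" unfolding En by blast
    then have "outer_measure_of p (g ` E l) \<le> outer_measure_of p (V n)"
      by (intro outer_measure_of_mono) auto
    with E(1)[of l] Vp show ?thesis by simp
  qed
  then have "c \<le> (INF n. emeasure p (V n))" by (rule INF_greatest)
  also have "\<dots> = emeasure p (\<Inter>n. V n)"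
    using Vp V(2) by (intro INF_emeasure_decseq) (auto simp: decseq_Suc_iff)
  finally have "c \<le> emeasure p (g ` ?K)" using V(3) by simp
  moreover have "g ` ?K \<in> sets p"
    using closedin_sets_borel_of[OF \<open>closedin X (g ` ?K)\<close>] p by simp
  ultimately show "\<exists>B\<in>sets p. B \<subseteq> g ` F \<and> c \<le> emeasure p B"
    by (intro bexI[of _ "g ` ?K"]) auto
qed

corollary continuous_image_of_closed_univ_measurable:
  fixes g :: "(nat \<Rightarrow> nat) \<Rightarrow> 'a"
  assumes "metrizable_space X" "continuous_map euclidean X g" "closed F"
  shows "g ` F \<in> sets (univ_completion (borel_of X))"
  using continuous_image_of_closed_in_completion[OF assms] continuous_map_image_subset_topspace[OF
    assms(2)]
  by (auto simp: sets_univ_completion space_prob_algebra prob_space.finite_measure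
    image_subset_iff Pi_iff)

section \<open>Jankov-von Neumann: universally measurable selection\<close>

text \<open>
The point \<open>\<alpha> x\<close> is the lexicographically least element of the closed fibre of \<open>g\<close> over \<open>x\<close>. It is
found digit by digit: \<open>m\<close> can follow the digits \<open>s\<close> iff \<open>x\<close> lies in the image of the cylinder of
\<open>s @ [m]\<close>, a universally measurable condition on \<open>x\<close> by Luzin's theorem. Since \<open>g\<close> is continuous,
the limit of the digits still lies in the fibre.
\<close>

theorem continuous_surjection_univ_measurable_section:
  fixes g :: "(nat \<Rightarrow> nat) \<Rightarrow> 'a"
  assumes X: "metrizable_space X" and g: "continuous_map euclidean X g"
    and onto: "range g = topspace X"
  obtains \<alpha> :: "'a \<Rightarrow> nat \<Rightarrow> nat" where "\<And>x. x \<in> topspace X \<Longrightarrow> g (\<alpha> x) = x"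
    "\<And>W. open W \<Longrightarrow> {x \<in> topspace X. \<alpha> x \<in> W} \<in> sets (univ_completion (borel_of X))"
proof -
  let ?U = "univ_completion (borel_of X)"
  define next_digit where "next_digit s x = (LEAST m. x \<in> g ` cylinder (s @ [m]))" for s x
  define prefix where "prefix = rec_nat (\<lambda>x. []) (\<lambda>_ pre x. pre x @ [next_digit (pre x) x])"
  have prefix_0: "prefix 0 x = []" and prefix_Suc: "prefix (Suc n) x =
      prefix n x @ [next_digit (prefix n x) x]" for n x
    by (simp_all add: prefix_def)
  define \<alpha> where "\<alpha> x n = next_digit (prefix n x) x" for x n
  have prefix_\<alpha>: "prefix n x = map (\<alpha> x) [0..<n]" for n x
    by (induction n) (simp_all add: prefix_0 prefix_Suc \<alpha>_def)
  have reach: "x \<in> g ` cylinder (prefix n x)" if x: "x \<in> topspace X" for n x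
  proof (induction n)
    case 0
    then show ?case using x onto by (simp add: prefix_0)
  next
    case (Suc n)
    then obtain \<beta> where "\<beta> \<in> cylinder (prefix n x)" "x = g \<beta>" by blast
    then have "x \<in> g ` cylinder (prefix n x @ [\<beta> (length (prefix n x))])"
      by (auto simp: cylinder_snoc)
    then show ?case unfolding prefix_Suc next_digit_def by (rule LeastI)
  qed
  have sect: "g (\<alpha> x) = x" if x: "x \<in> topspace X" for x
  proof (rule ccontr)
    assume neq: "g (\<alpha> x) \<noteq> x"
    have "g (\<alpha> x) \<in> topspace X" using onto by blast
    then have o: "openin X (topspace X - {x})" and "g (\<alpha> x) \<in> topspace X - {x}"
      using X x neq by (auto intro!: openin_diff closedin_t1_singleton metrizable_imp_t1_space)
    then have "open (g -` (topspace X - {x}))"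
      using openin_continuous_map_preimage[OF g o] by (simp add: vimage_def)
    from open_contains_cylinder[OF this, of "\<alpha> x"] \<open>g (\<alpha> x) \<in> topspace X - {x}\<close>
    obtain n where "cylinder (prefix n x) \<subseteq> g -` (topspace X - {x})"
      unfolding prefix_\<alpha> by auto
    with reach[OF x, of n] show False by auto
  qed
  have digit[measurable]: "next_digit s \<in> ?U \<rightarrow>\<^sub>M count_space UNIV" for s
  proof -
    have "Measurable.pred ?U (\<lambda>x. x \<in> g ` cylinder (s @ [m]))" for m
      using continuous_image_of_closed_univ_measurable[OF X g closed_cylinder]
        by (rule pred_sets2) simp
    then show ?thesis unfolding next_digit_def[abs_def] by (rule measurable_Least)
  qed
  have prefix_measurable: "prefix n \<in> ?U \<rightarrow>\<^sub>M count_space UNIV" for n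
  proof (induction n)
    case 0
    show ?case by (simp add: prefix_0[abs_def])
  next
    case (Suc n)
    have "(\<lambda>x. s @ [next_digit s x]) \<in> ?U \<rightarrow>\<^sub>M count_space UNIV" for s
      by (rule measurable_compose[OF digit]) simp
    from measurable_compose_countable[OF this Suc]
    show ?case by (simp add: prefix_Suc[abs_def])
  qed
  have "{x \<in> topspace X. \<alpha> x \<in> W} \<in> sets ?U" if W: "open W" for W
  proof -
    have "{x \<in> topspace X. \<alpha> x \<in> W} = (\<Union>n. prefix n -` {s. cylinder s \<subseteq> W} \<inter> space ?U)"
      using open_contains_cylinder[OF W] unfolding prefix_\<alpha>
      by (auto simp: subset_iff mem_cylinder_prefix)
    also have "\<dots> \<in> sets ?U"
      by (intro sets.countable_UN image_subsetI measurable_sets[OF prefix_measurable]) simp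
    finally show ?thesis .
  qed
  with sect show thesis by (rule that)
qed

text \<open>
Write \<open>A\<close> as the image of a continuous map \<open>f\<close>. A section of \<open>fst \<circ> f\<close> followed by \<open>snd \<circ> f\<close>
selects from \<open>A\<close>.
\<close>

lemma analytic_univ_measurable_selector:
  assumes X: "metrizable_space X" and A: "analytic_in (prod_topology X Y) A"
    and ne: "topspace X \<noteq> {}" and sect: "\<And>x. x \<in> topspace X \<Longrightarrow> \<exists>y. (x, y) \<in> A"
  obtains \<phi> where "\<phi> \<in> univ_completion (borel_of X) \<rightarrow>\<^sub>M borel_of Y"
    "\<And>x. x \<in> topspace X \<Longrightarrow> (x, \<phi> x) \<in> A"
proof -
  have "A \<noteq> {}" using ne sect by blast
  then obtain f where f: "continuous_map (euclidean :: (nat \<Rightarrow> nat) topology) (prod_topology X Y)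
      f" and Af: "A = range f"
    using A unfolding analytic_in_def by blast
  have f1: "continuous_map euclidean X (fst \<circ> f)" and f2: "continuous_map euclidean Y (snd \<circ> f)"
    using f continuous_map_compose continuous_map_fst continuous_map_snd by blast+
  have fsp: "f \<beta> \<in> topspace X \<times> topspace Y" for \<beta>
    using continuous_map_image_subset_topspace[OF f] by auto
  have "range (fst \<circ> f) = topspace X"
  proof
    show "range (fst \<circ> f) \<subseteq> topspace X" using fsp by (auto simp: mem_Times_iff)
    show "topspace X \<subseteq> range (fst \<circ> f)"
    proof
      fix x assume "x \<in> topspace X"
      then obtain y where "(x, y) \<in> range f" using sect Af by blast
      then show "x \<in> range (fst \<circ> f)"
        by (metis (no_types, lifting) comp_apply fst_conv imageE rangeI)
    qed
  qed
  then obtain \<alpha> where \<alpha>: "\<And>x. x \<in> topspace X \<Longrightarrow> (fst \<circ> f) (\<alpha> x) = x"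
    "\<And>W. open W \<Longrightarrow> {x \<in> topspace X. \<alpha> x \<in> W} \<in> sets (univ_completion (borel_of X))"
    using continuous_surjection_univ_measurable_section[OF X f1] by metis
  show thesis
  proof (rule that[of "\<lambda>x. snd (f (\<alpha> x))"])
    show "(\<lambda>x. snd (f (\<alpha> x))) \<in> univ_completion (borel_of X) \<rightarrow>\<^sub>M borel_of Y"
    proof (rule measurable_borel_ofI)
      fix V assume "openin Y V"
      then have "open ((snd \<circ> f) -` V)"
        using openin_continuous_map_preimage[OF f2] by (simp add: vimage_def)
      from \<alpha>(2)[OF this]
      show "(\<lambda>x. snd (f (\<alpha> x))) -` V \<inter> space (univ_completion (borel_of X)) \<in>
          sets (univ_completion (borel_of X))"
        by (simp add: vimage_def Int_def conj_commute)
    qed (use fsp in \<open>auto simp: mem_Times_iff\<close>)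
    show "(x, snd (f (\<alpha> x))) \<in> A" if "x \<in> topspace X" for x
    proof -
      have "f (\<alpha> x) = (x, snd (f (\<alpha> x)))" using \<alpha>(1)[OF that] by (metis comp_apply prod.collapse)
      then show ?thesis using Af by (metis rangeI)
    qed
  qed
qed

lemma cdt_MP_D:
  assumes "cdt_MP D"
  shows "metrizable_space (states D)" "metrizable_space (actions D)" "second_countable (actions D)"
    "topspace (states D) \<noteq> {}"
    "kernel D \<in> (state_algebra D \<Otimes>\<^sub>M action_algebra D) \<rightarrow>\<^sub>M prob_algebra (state_algebra D)"
  using assms borel_space_imp_metrizable_second_countable unfolding cdt_MP_def by auto

text \<open>
The policy always plays the point mass at the value of a selector of the set of admissible actions.
The admissible actions contain this atom, and what else they contain is a null set, which makes them
measurable for the completion.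
\<close>

theorem policies_nonempty:
  assumes D: "cdt_MP D"
  shows "policies D \<noteq> {}"
proof -
  let ?U = "action_algebra D"
  obtain \<phi> where \<phi>: "\<phi> \<in> univ_completion (state_algebra D) \<rightarrow>\<^sub>M ?U"
    "\<And>x. x \<in> topspace (states D) \<Longrightarrow> (x, \<phi> x) \<in> admissible D"
  proof (rule analytic_univ_measurable_selector[of "states D" "actions D" "admissible D"])
    show "\<exists>u. (x, u) \<in> admissible D" if "x \<in> topspace (states D)" for x
      using D that unfolding cdt_MP_def admissible_actions_def by blast
  qed (use D cdt_MP_D[OF D] in \<open>auto simp: cdt_MP_def\<close>)
  define \<pi> where "\<pi> n h = return ?U (\<phi> (snd h))" for n :: nat and h :: "('a, 'b) history"
  have "\<pi> n \<in> univ_completion (history_algebra D n) \<rightarrow>\<^sub>M prob_algebra ?U" for n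
  proof -
    have "snd \<in> history_algebra D n \<rightarrow>\<^sub>M state_algebra D" by (simp add: history_algebra_def)
    from measurable_compose[OF measurable_compose[OF measurable_univ_completion[OF this] \<phi>(1)]
      measurable_return_prob_space]
    show ?thesis by (simp add: \<pi>_def[abs_def])
  qed
  moreover have "emeasure (completion (\<pi> n h)) (admissible_actions D (snd h)) = 1"
    if h: "h \<in> space (history_algebra D n)" for n h
  proof -
    have x: "snd h \<in> topspace (states D)" using h
      by (auto simp: history_algebra_def space_pair_measure)
    let ?u = "\<phi> (snd h)" and ?p = "return ?U (\<phi> (snd h))" and ?K = "admissible_actions D (snd h)"
    have u: "?u \<in> topspace (actions D)" using measurable_space[OF \<phi>(1), of "snd h"] x by simp
    then have sing: "{?u} \<in> sets ?U" using cdt_MP_D(2)[OF D] by (intro singleton_sets_borel_of) auto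
    interpret p: prob_space ?p using u by (intro prob_space_return) simp
    have uK: "?u \<in> ?K" using u \<phi>(2)[OF x] by (simp add: admissible_actions_def)
    have "space ?p - {?u} \<in> null_sets ?p"
      using sets.compl_sets[OF sing] sing u by (auto simp: null_sets_def)
    then have K: "?K \<in> sets (completion ?p)"
      using uK sing
      by (intro sets_completionI[of ?K "{?u}" "?K - {?u}" "space ?p - {?u}"])
        (auto simp: admissible_actions_def)
    have "1 = emeasure (completion ?p) {?u}" using sing u by simp
    also have "\<dots> \<le> emeasure (completion ?p) ?K" using K uK by (intro emeasure_mono) auto
    finally have "1 \<le> emeasure (completion ?p) ?K" .
    moreover have "emeasure (completion ?p) (space ?p) = 1"
      unfolding emeasure_completion[OF sets_completionI_sets[OF sets.top]] main_part[OF sets.top]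
      by (rule p.emeasure_space_1)
    then have "emeasure (completion ?p) ?K \<le> 1"
      using emeasure_space[of "completion ?p" ?K] by simp
    ultimately show ?thesis unfolding \<pi>_def by (intro antisym)
  qed
  ultimately have "\<pi> \<in> policies D" by (simp add: policies_def)
  then show ?thesis by blast
qed

section \<open>Existence of path laws\<close>

text \<open>
The Ionescu-Tulcea theorem takes the transition kernels \<open>Q n\<close> as given. Here \<open>Q n\<close> may be chosen
with knowledge of the law of the first \<open>n\<close> coordinates, the relation \<open>R\<close> saying which choices are
good. The laws \<open>\<mu> n\<close> and the kernels are defined by a common recursion, and the measure built
from these kernels turns out to have the marginals \<open>\<mu> n\<close>.
\<close>

lemma adapted_Ionescu_Tulcea:
  fixes Z :: "'a measure"
    and R :: "nat \<Rightarrow> (nat \<Rightarrow> 'a) measure \<Rightarrow> ((nat \<Rightarrow> 'a) \<Rightarrow> 'a measure) \<Rightarrow> bool"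
  defines "\<Omega> \<equiv> \<lambda>n. \<Pi>\<^sub>M i\<in>{..<n}. Z"
  assumes ex: "\<forall>n. \<forall>\<mu> \<in> space (prob_algebra (\<Omega> n)). \<exists>Q \<in> \<Omega> n \<rightarrow>\<^sub>M prob_algebra Z. R n \<mu> Q"
  shows "\<exists>P Q. P \<in> space (prob_algebra (\<Pi>\<^sub>M i\<in>UNIV. Z)) \<and>
    (\<forall>n. R n (distr P (\<Omega> n) (\<lambda>\<omega>. restrict \<omega> {..<n})) (Q n)) \<and>
    (\<forall>n. \<forall>f \<in> borel_measurable (\<Omega> n \<Otimes>\<^sub>M Z).
       (\<integral>\<^sup>+\<omega>. f (restrict \<omega> {..<n}, \<omega> n) \<partial>P) =
       (\<integral>\<^sup>+\<omega>. \<integral>\<^sup>+z. f (\<omega>, z) \<partial>Q n \<omega> \<partial>distr P (\<Omega> n) (\<lambda>\<omega>. restrict \<omega> {..<n})))"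
proof -
  have \<Omega>: "\<Omega> n = PiM {0..<n} (\<lambda>_. Z)" for n by (simp add: \<Omega>_def lessThan_atLeast0)
  \<comment> \<open>A choice of a good kernel for each possible law; the laws that occur are fixed next.\<close>
  define V where "V n \<mu> = (SOME Q. Q \<in> \<Omega> n \<rightarrow>\<^sub>M prob_algebra Z \<and> R n \<mu> Q)" for n \<mu>
  have V: "V n \<mu> \<in> \<Omega> n \<rightarrow>\<^sub>M prob_algebra Z \<and> R n \<mu> (V n \<mu>)" if "\<mu> \<in> space (prob_algebra (\<Omega> n))"
    for n \<mu>
  proof -
    have "\<exists>Q. Q \<in> \<Omega> n \<rightarrow>\<^sub>M prob_algebra Z \<and> R n \<mu> Q" using ex that by blast
    from someI_ex[OF this] show ?thesis by (simp only: V_def)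
  qed
  define \<mu> where "\<mu> = rec_nat (return (\<Omega> 0) (\<lambda>_. undefined))
    (\<lambda>n m. m \<bind> (\<lambda>\<omega>. distr (V n m \<omega>) (\<Omega> (Suc n)) (fun_upd \<omega> n)))"
  have \<mu>_0: "\<mu> 0 = return (\<Omega> 0) (\<lambda>_. undefined)"
    and \<mu>_Suc: "\<mu> (Suc n) = \<mu> n \<bind> (\<lambda>\<omega>. distr (V n (\<mu> n) \<omega>) (\<Omega> (Suc n)) (fun_upd \<omega> n))" for n
    by (simp_all add: \<mu>_def)
  have upd: "(\<lambda>(\<omega>, z). fun_upd \<omega> n z) \<in> \<Omega> n \<Otimes>\<^sub>M Z \<rightarrow>\<^sub>M \<Omega> (Suc n)" for n
    unfolding split_beta' \<Omega> by (rule measurable_fun_upd[where J="{0..<n}"]) auto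
  have \<mu>: "\<mu> n \<in> space (prob_algebra (\<Omega> n))" for n
  proof (induction n)
    case 0
    show ?case unfolding \<mu>_0 space_prob_algebra \<Omega>
      by (auto intro!: prob_space_return simp: space_PiM)
  next
    case (Suc n)
    have "(\<lambda>\<omega>. distr (V n (\<mu> n) \<omega>) (\<Omega> (Suc n)) (fun_upd \<omega> n)) \<in> \<Omega> n \<rightarrow>\<^sub>M prob_algebra (\<Omega> (Suc n))"
      using V[OF Suc] upd by (intro measurable_distr_prob_space2[where M=Z]) auto
    from prob_space_bind'[OF Suc this] sets_bind'[OF Suc this]
    show ?case unfolding \<mu>_Suc space_prob_algebra by simp
  qed
  define Q where "Q n = V n (\<mu> n)" for n
  have Q: "Q n \<in> \<Omega> n \<rightarrow>\<^sub>M prob_algebra Z" and RQ: "R n (\<mu> n) (Q n)" for n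
    using V[OF \<mu>] by (auto simp: Q_def)
  interpret IT: Ionescu_Tulcea Q "\<lambda>_. Z"
  proof (rule Ionescu_Tulcea.intro, goal_cases)
    case (1 i)
    show ?case
      using measurable_prob_algebraD[OF Q[of i]] by (simp add: \<Omega>)
    case (2 i \<omega>)
    then show ?case
      using measurable_space[OF Q[of i]] by (simp add: \<Omega> space_prob_algebra)
  qed
  have eP: "IT.eP n = (\<lambda>\<omega>. distr (Q n \<omega>) (\<Omega> (Suc n)) (fun_upd \<omega> n))" for n
    by (simp add: IT.eP_def[abs_def] \<Omega>)
  have C: "IT.C 0 n (\<lambda>_. undefined) = \<mu> n" for n
    by (induction n) (simp_all add: \<mu>_0 \<mu>_Suc eP Q_def[symmetric] \<Omega>)
  let ?P = "IT.PF.lim"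
  have sP: "sets ?P = sets (\<Pi>\<^sub>M i\<in>UNIV. Z)"
    using IT.PF.sets_lim by simp
  have restr: "(\<lambda>\<omega>. restrict \<omega> {..<n}) \<in> ?P \<rightarrow>\<^sub>M \<Omega> n" for n
    unfolding measurable_cong_sets[OF sP refl] \<Omega>_def by (rule measurable_restrict_subset) simp
  have marg: "distr ?P (\<Omega> n) (\<lambda>\<omega>. restrict \<omega> {..<n}) = \<mu> n" for n
  proof -
    have "distr ?P (\<Omega> n) (\<lambda>\<omega>. restrict \<omega> {..<n}) = IT.CI {0..<n}"
      using IT.distr_lim[of "{0..<n}"] by (simp add: \<Omega> lessThan_atLeast0)
    also have "\<dots> = IT.C 0 n (\<lambda>_. undefined)"
    proof (rule measure_eqI)
      show s: "sets (IT.CI {0..<n}) = sets (IT.C 0 n (\<lambda>_. undefined))"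
        by (simp add: IT.CI_def IT.sets_C)
      fix A assume "A \<in> sets (IT.CI {0..<n})"
      then have "A \<in> sets (PiM {0..<n} (\<lambda>_. Z))" by (simp add: IT.CI_def)
      moreover from sets.sets_into_space[OF this] have "IT.PF.emb {0..<n} {0..<n} A = A"
        by (intro prod_emb_id) (simp add: space_PiM)
      ultimately show "emeasure (IT.CI {0..<n}) A = emeasure (IT.C 0 n (\<lambda>_. undefined)) A"
        by (simp add: IT.emeasure_CI[of _ n])
    qed
    finally show ?thesis unfolding C .
  qed
  have "prob_space ?P"
  proof (rule prob_space_distrD[OF restr[of 0]])
    show "prob_space (distr ?P (\<Omega> 0) (\<lambda>\<omega>. restrict \<omega> {..<0}))"
      unfolding marg using \<mu>[of 0] by (simp add: space_prob_algebra)
  qed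
  with sP have P: "?P \<in> space (prob_algebra (\<Pi>\<^sub>M i\<in>UNIV. Z))" by (simp add: space_prob_algebra)
  have int: "(\<integral>\<^sup>+\<omega>. f (restrict \<omega> {..<n}, \<omega> n) \<partial>?P) = (\<integral>\<^sup>+\<omega>. \<integral>\<^sup>+z. f (\<omega>, z) \<partial>Q n \<omega> \<partial>\<mu> n)"
    if f[measurable]: "f \<in> borel_measurable (\<Omega> n \<Otimes>\<^sub>M Z)" for n f
  proof -
    define g where "g \<omega> = f (restrict \<omega> {..<n}, \<omega> n)" for \<omega>
    have split: "(\<lambda>\<omega>. (restrict \<omega> {..<n}, \<omega> n)) \<in> \<Omega> (Suc n) \<rightarrow>\<^sub>M \<Omega> n \<Otimes>\<^sub>M Z"
      unfolding \<Omega>_def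
      by (intro measurable_Pair measurable_restrict_subset measurable_component_singleton) auto
    have g: "g \<in> borel_measurable (\<Omega> (Suc n))"
      unfolding g_def[abs_def] by (rule measurable_compose[OF split f])
    have ker: "(\<lambda>\<omega>. distr (Q n \<omega>) (\<Omega> (Suc n)) (fun_upd \<omega> n)) \<in> \<Omega> n \<rightarrow>\<^sub>M subprob_algebra (\<Omega> (Suc n))"
      using Q upd by (intro measurable_prob_algebraD measurable_distr_prob_space2[where M=Z]) auto
    have "(\<integral>\<^sup>+\<omega>. f (restrict \<omega> {..<n}, \<omega> n) \<partial>?P) = (\<integral>\<^sup>+\<omega>. g (restrict \<omega> {..<Suc n}) \<partial>?P)"
      by (simp add: g_def min_def Int_absorb1 subset_iff)
    also have "\<dots> = (\<integral>\<^sup>+\<omega>. g \<omega> \<partial>\<mu> (Suc n))"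
      unfolding marg[symmetric] using g restr by (subst nn_integral_distr) auto
    also have "\<dots> = (\<integral>\<^sup>+\<omega>. \<integral>\<^sup>+\<omega>'. g \<omega>' \<partial>distr (Q n \<omega>) (\<Omega> (Suc n)) (fun_upd \<omega> n) \<partial>\<mu> n)"
      unfolding \<mu>_Suc Q_def[symmetric]
      using \<mu>[of n] ker by (intro nn_integral_bind[OF g])
        (simp add: space_prob_algebra cong: measurable_cong_sets)
    also have "\<dots> = (\<integral>\<^sup>+\<omega>. \<integral>\<^sup>+z. f (\<omega>, z) \<partial>Q n \<omega> \<partial>\<mu> n)"
    proof (rule nn_integral_cong)
      fix \<omega> assume "\<omega> \<in> space (\<mu> n)"
      then have \<omega>: "\<omega> \<in> space (\<Omega> n)"
        using \<mu>[of n] by (auto simp: space_prob_algebra dest: sets_eq_imp_space_eq)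
      have "sets (Q n \<omega>) = sets Z"
        using measurable_space[OF Q \<omega>] by (simp add: space_prob_algebra)
      moreover have "fun_upd \<omega> n \<in> Z \<rightarrow>\<^sub>M \<Omega> (Suc n)"
        using measurable_compose[OF measurable_Pair1'[OF \<omega>] upd] by simp
      ultimately have "(\<integral>\<^sup>+\<omega>'. g \<omega>' \<partial>distr (Q n \<omega>) (\<Omega> (Suc n)) (fun_upd \<omega> n)) =
          (\<integral>\<^sup>+z. g (fun_upd \<omega> n z) \<partial>Q n \<omega>)"
        using g by (intro nn_integral_distr) (auto cong: measurable_cong_sets)
      also have "\<dots> = (\<integral>\<^sup>+z. f (\<omega>, z) \<partial>Q n \<omega>)"
        using \<omega> by (intro nn_integral_cong)
          (auto simp: g_def \<Omega>_def space_PiM PiE_iff extensional_restrict)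
      finally show "(\<integral>\<^sup>+\<omega>'. g \<omega>' \<partial>distr (Q n \<omega>) (\<Omega> (Suc n)) (fun_upd \<omega> n)) =
          (\<integral>\<^sup>+z. f (\<omega>, z) \<partial>Q n \<omega>)" .
    qed
    finally show ?thesis .
  qed
  show ?thesis
    by (intro exI[of _ ?P] exI[of _ Q] conjI allI ballI P) (simp_all add: marg RQ int)
qed

lemma space_history_algebra:
  "space (history_algebra D n) = space (\<Pi>\<^sub>M i\<in>{..<n}. state_algebra D \<Otimes>\<^sub>M action_algebra D) \<times>
      topspace (states D)"
  by (simp add: history_algebra_def space_pair_measure)

lemma measurable_state_at: "(\<lambda>\<omega>. state_at \<omega> n) \<in> path_algebra D \<rightarrow>\<^sub>M state_algebra D"
  and measurable_action_at: "(\<lambda>\<omega>. action_at \<omega> n) \<in> path_algebra D \<rightarrow>\<^sub>M action_algebra D"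
proof -
  have "(\<lambda>\<omega>. \<omega> n) \<in> path_algebra D \<rightarrow>\<^sub>M state_algebra D \<Otimes>\<^sub>M action_algebra D"
    unfolding path_algebra_def by (rule measurable_component_singleton) simp
  from measurable_compose[OF this measurable_fst] measurable_compose[OF this measurable_snd]
  show "(\<lambda>\<omega>. state_at \<omega> n) \<in> path_algebra D \<rightarrow>\<^sub>M state_algebra D"
    "(\<lambda>\<omega>. action_at \<omega> n) \<in> path_algebra D \<rightarrow>\<^sub>M action_algebra D"
    by (simp_all add: state_at_def action_at_def)
qed

lemma measurable_history_of: "(\<lambda>\<omega>. history_of \<omega> n) \<in> path_algebra D \<rightarrow>\<^sub>M history_algebra D n"
proof -
  have "(\<lambda>\<omega>. restrict \<omega> {..<n}) \<in> path_algebra D \<rightarrow>\<^sub>M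
      (\<Pi>\<^sub>M i\<in>{..<n}. state_algebra D \<Otimes>\<^sub>M action_algebra D)"
    unfolding path_algebra_def by (rule measurable_restrict_subset) simp
  then show ?thesis
    unfolding history_of_def history_algebra_def by (intro measurable_Pair measurable_state_at)
qed

text \<open>
The coordinate at time \<open>n\<close> is the pair of state and action, so one transition draws the state from
\<open>next_law\<close> and then the action from a Borel kernel \<open>\<kappa>\<close>. The law \<open>hist_law\<close> of the history is known
before the action is drawn, and \<open>\<kappa>\<close> is a version of \<open>\<pi> n\<close> that agrees with it almost surely for this
law. The defining identity for the actions holds for \<open>\<kappa>\<close> by iterated integration. It passes to \<open>\<pi> n\<close>
because the kernel enters it only under an integral over the law of the history.
\<close>

theorem path_law_exists:
  fixes D :: "('x, 'u) mp"
  assumes D: "cdt_MP D" and pol: "\<pi> \<in> policies D" and x: "x \<in> topspace (states D)"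
  shows "\<exists>P. is_path_law D \<pi> x P"
proof -
  let ?X = "state_algebra D" and ?U = "action_algebra D"
  let ?Z = "?X \<Otimes>\<^sub>M ?U" and ?H = "history_algebra D"
  let ?\<Omega> = "\<lambda>n::nat. \<Pi>\<^sub>M i\<in>{..<n}. ?Z"
  note T = cdt_MP_D(5)[OF D]
  have \<pi>: "\<pi> n \<in> univ_completion (?H n) \<rightarrow>\<^sub>M prob_algebra ?U" for n
    using pol by (simp add: policies_def)
  obtain G where G: "countable G" "Int_stable G" "G \<subseteq> Pow (space ?U)"
    "sets ?U = sigma_sets (space ?U) G"
    using second_countable_imp_countable_generator[OF cdt_MP_D(3)[OF D]] by (metis space_borel_of)
  have H: "?H n = ?\<Omega> n \<Otimes>\<^sub>M ?X" for n by (simp add: history_algebra_def)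
  \<comment> \<open>At time \<open>0\<close> the initial state, afterwards a transition from the last state and action.\<close>
  define next_law where "next_law n \<omega> = (if n = 0 then return ?X x else kernel D (\<omega> (n - 1)))"
    for n and \<omega> :: "('x, 'u) path"
  have next_law: "next_law n \<in> ?\<Omega> n \<rightarrow>\<^sub>M prob_algebra ?X" for n
  proof (cases n)
    case 0
    have "return ?X x \<in> space (prob_algebra ?X)"
      using x by (simp add: space_prob_algebra prob_space_return)
    then show ?thesis using 0 by (simp add: next_law_def[abs_def])
  next
    case (Suc m)
    have "(\<lambda>\<omega>. kernel D (\<omega> m)) \<in> ?\<Omega> n \<rightarrow>\<^sub>M prob_algebra ?X"
      using Suc by (intro measurable_compose[OF _ T] measurable_component_singleton) auto
    then show ?thesis using Suc by (simp add: next_law_def[abs_def])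
  qed
  define step where "step n \<kappa> \<omega> = next_law n \<omega> \<bind> (\<lambda>y. distr (\<kappa> (\<omega>, y)) ?Z (Pair y))"
    for n \<omega> and \<kappa> :: "('x, 'u) history \<Rightarrow> 'u measure"
  have inner: "(\<lambda>(\<omega>, y). distr (\<kappa> (\<omega>, y)) ?Z (Pair y)) \<in> ?\<Omega> n \<Otimes>\<^sub>M ?X \<rightarrow>\<^sub>M prob_algebra ?Z"
    if "\<kappa> \<in> ?H n \<rightarrow>\<^sub>M prob_algebra ?U" for n \<kappa>
    using that unfolding H split_beta' by (intro measurable_distr_prob_space2[where M="?U"]) auto
  have step: "step n \<kappa> \<in> ?\<Omega> n \<rightarrow>\<^sub>M prob_algebra ?Z" if "\<kappa> \<in> ?H n \<rightarrow>\<^sub>M prob_algebra ?U" for n \<kappa>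
    unfolding step_def[abs_def] by (rule measurable_bind_prob_space2[OF next_law inner[OF that]])
  have nn_integral_step: "(\<integral>\<^sup>+z. f z \<partial>step n \<kappa> \<omega>) = (\<integral>\<^sup>+y. \<integral>\<^sup>+u. f (y, u) \<partial>\<kappa> (\<omega>, y) \<partial>next_law n \<omega>)"
    if \<kappa>: "\<kappa> \<in> ?H n \<rightarrow>\<^sub>M prob_algebra ?U" and \<omega>: "\<omega> \<in> space (?\<Omega> n)" and f: "f \<in> borel_measurable ?Z"
    for n \<kappa> \<omega> f
  proof -
    have N: "sets (next_law n \<omega>) = sets ?X"
      using measurable_space[OF next_law \<omega>] by (simp add: space_prob_algebra)
    have "(\<lambda>y. distr (\<kappa> (\<omega>, y)) ?Z (Pair y)) \<in> ?X \<rightarrow>\<^sub>M prob_algebra ?Z"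
      using measurable_compose[OF measurable_Pair1'[OF \<omega>] inner[OF \<kappa>]] by simp
    then have "(\<integral>\<^sup>+z. f z \<partial>step n \<kappa> \<omega>) =
        (\<integral>\<^sup>+y. \<integral>\<^sup>+z. f z \<partial>distr (\<kappa> (\<omega>, y)) ?Z (Pair y) \<partial>next_law n \<omega>)"
      unfolding step_def using N
      by (intro nn_integral_bind[OF f])
        (auto intro: measurable_prob_algebraD cong: measurable_cong_sets)
    also have "\<dots> = (\<integral>\<^sup>+y. \<integral>\<^sup>+u. f (y, u) \<partial>\<kappa> (\<omega>, y) \<partial>next_law n \<omega>)"
    proof (rule nn_integral_cong)
      fix y assume "y \<in> space (next_law n \<omega>)"
      then have y: "y \<in> space ?X" using sets_eq_imp_space_eq[OF N] by simp
      then have "sets (\<kappa> (\<omega>, y)) = sets ?U"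
        using measurable_space[OF \<kappa>, of "(\<omega>, y)"] \<omega>
          by (simp add: space_prob_algebra H space_pair_measure)
      then show "(\<integral>\<^sup>+z. f z \<partial>distr (\<kappa> (\<omega>, y)) ?Z (Pair y)) = (\<integral>\<^sup>+u. f (y, u) \<partial>\<kappa> (\<omega>, y))"
        using f y by (intro nn_integral_distr) (auto cong: measurable_cong_sets)
    qed
    finally show ?thesis .
  qed
  define hist_law where "hist_law n \<mu> = \<mu> \<bind> (\<lambda>\<omega>. distr (next_law n \<omega>) (?H n) (Pair \<omega>))" for n \<mu>
  have hist_kernel: "(\<lambda>\<omega>. distr (next_law n \<omega>) (?H n) (Pair \<omega>)) \<in> ?\<Omega> n \<rightarrow>\<^sub>M prob_algebra (?H n)"
    for n
    using next_law unfolding H by (intro measurable_distr_prob_space2[where M="?X"]) auto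
  define R where "R n \<mu> Q \<longleftrightarrow>
      (\<exists>\<kappa> \<in> ?H n \<rightarrow>\<^sub>M prob_algebra ?U. Q = step n \<kappa> \<and> (AE h in hist_law n \<mu>. \<kappa> h = \<pi> n h))" for n \<mu> Q
  have "\<exists>Q \<in> ?\<Omega> n \<rightarrow>\<^sub>M prob_algebra ?Z. R n \<mu> Q" if \<mu>: "\<mu> \<in> space (prob_algebra (?\<Omega> n))" for n \<mu>
  proof -
    have "hist_law n \<mu> \<in> space (prob_algebra (?H n))"
      using prob_space_bind'[OF \<mu> hist_kernel] sets_bind'[OF \<mu> hist_kernel]
      by (simp add: hist_law_def space_prob_algebra)
    from kernel_borel_version[OF this \<pi> G] obtain \<kappa> where
      "\<kappa> \<in> ?H n \<rightarrow>\<^sub>M prob_algebra ?U" "AE h in hist_law n \<mu>. \<kappa> h = \<pi> n h" by blast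
    with step show ?thesis unfolding R_def by (intro bexI[of _ "step n \<kappa>"]) auto
  qed
  then have "\<forall>n. \<forall>\<mu> \<in> space (prob_algebra (?\<Omega> n)). \<exists>Q \<in> ?\<Omega> n \<rightarrow>\<^sub>M prob_algebra ?Z. R n \<mu> Q" by blast
  from adapted_Ionescu_Tulcea[of ?Z R, OF this]
  obtain P Q where P: "P \<in> space (prob_algebra (\<Pi>\<^sub>M i\<in>UNIV. ?Z))"
    and RQ: "\<forall>n. R n (distr P (?\<Omega> n) (\<lambda>\<omega>. restrict \<omega> {..<n})) (Q n)"
    and int': "\<forall>n. \<forall>f \<in> borel_measurable (?\<Omega> n \<Otimes>\<^sub>M ?Z).
       (\<integral>\<^sup>+\<omega>. f (restrict \<omega> {..<n}, \<omega> n) \<partial>P) =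
       (\<integral>\<^sup>+\<omega>. \<integral>\<^sup>+z. f (\<omega>, z) \<partial>Q n \<omega> \<partial>distr P (?\<Omega> n) (\<lambda>\<omega>. restrict \<omega> {..<n}))"
    by (elim exE conjE)
  note int = bspec[OF spec[OF int']]
  define \<mu> where "\<mu> n = distr P (?\<Omega> n) (\<lambda>\<omega>. restrict \<omega> {..<n})" for n
  have Pp: "P \<in> space (prob_algebra (path_algebra D))" using P by (simp add: path_algebra_def)
  then have sP: "sets P = sets (path_algebra D)" by (simp add: space_prob_algebra)
  have restr: "(\<lambda>\<omega>. restrict \<omega> {..<n}) \<in> P \<rightarrow>\<^sub>M ?\<Omega> n" for n
    unfolding measurable_cong_sets[OF sP refl] path_algebra_def
      by (rule measurable_restrict_subset) simp
  have \<mu>: "\<mu> n \<in> space (prob_algebra (?\<Omega> n))" for n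
    unfolding \<mu>_def using prob_space.prob_space_distr[OF _ restr] P
      by (simp add: space_prob_algebra)
  have space_\<mu>: "space (\<mu> n) = space (?\<Omega> n)" for n by (simp add: \<mu>_def)
  obtain \<kappa> where \<kappa>: "\<And>n. \<kappa> n \<in> ?H n \<rightarrow>\<^sub>M prob_algebra ?U" and Q\<kappa>: "\<And>n. Q n = step n (\<kappa> n)"
    and \<kappa>\<pi>: "\<And>n. AE h in hist_law n (\<mu> n). \<kappa> n h = \<pi> n h"
    using RQ unfolding R_def \<mu>_def[symmetric] by metis
  have hist_meas: "(\<lambda>\<omega>. history_of \<omega> n) \<in> P \<rightarrow>\<^sub>M ?H n" for n
    using measurable_history_of by (simp add: measurable_cong_sets[OF sP refl])
  have act_meas: "(\<lambda>\<omega>. action_at \<omega> n) \<in> P \<rightarrow>\<^sub>M ?U" for n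
    using measurable_action_at by (simp add: measurable_cong_sets[OF sP refl])
  have int_act: "(\<integral>\<^sup>+\<omega>. f (history_of \<omega> n, action_at \<omega> n) \<partial>P) =
      (\<integral>\<^sup>+\<omega>. \<integral>\<^sup>+y. \<integral>\<^sup>+u. f ((\<omega>, y), u) \<partial>\<kappa> n (\<omega>, y) \<partial>next_law n \<omega> \<partial>\<mu> n)"
    if f: "f \<in> borel_measurable (?H n \<Otimes>\<^sub>M ?U)" for n f
  proof -
    define g where "g = (\<lambda>(\<omega>, z). f ((\<omega>, fst z), snd z))"
    have g: "g \<in> borel_measurable (?\<Omega> n \<Otimes>\<^sub>M ?Z)"
      unfolding g_def split_beta' by (rule measurable_compose[OF _ f]) (simp add: H)
    have "(\<integral>\<^sup>+\<omega>. f (history_of \<omega> n, action_at \<omega> n) \<partial>P) = (\<integral>\<^sup>+\<omega>. g (restrict \<omega> {..<n}, \<omega> n) \<partial>P)"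
      by (simp add: g_def history_of_def state_at_def action_at_def)
    also have "\<dots> = (\<integral>\<^sup>+\<omega>. \<integral>\<^sup>+z. g (\<omega>, z) \<partial>step n (\<kappa> n) \<omega> \<partial>\<mu> n)"
      unfolding int[OF g] Q\<kappa> \<mu>_def ..
    also have "\<dots> = (\<integral>\<^sup>+\<omega>. \<integral>\<^sup>+y. \<integral>\<^sup>+u. g (\<omega>, (y, u)) \<partial>\<kappa> n (\<omega>, y) \<partial>next_law n \<omega> \<partial>\<mu> n)"
      using g by (intro nn_integral_cong nn_integral_step[OF \<kappa>]) (auto simp: space_\<mu>)
    finally show ?thesis by (simp add: g_def)
  qed
  have \<kappa>_prob: "prob_space (\<kappa> n (\<omega>, y))" if "\<omega> \<in> space (\<mu> n)" "y \<in> space (next_law n \<omega>)" for n \<omega> y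
  proof -
    have "sets (next_law n \<omega>) = sets ?X"
      using measurable_space[OF next_law, of \<omega> n] that by (simp add: space_prob_algebra space_\<mu>)
    with that have "y \<in> space ?X" by (auto dest: sets_eq_imp_space_eq)
    with that measurable_space[OF \<kappa>, of "(\<omega>, y)" n] show ?thesis
      by (simp add: space_prob_algebra H space_pair_measure space_\<mu>)
  qed
  have int_hist: "(\<integral>\<^sup>+\<omega>. f (history_of \<omega> n) \<partial>P) = (\<integral>\<^sup>+\<omega>. \<integral>\<^sup>+y. f (\<omega>, y) \<partial>next_law n \<omega> \<partial>\<mu> n)"
    if f: "f \<in> borel_measurable (?H n)" for n f
  proof -
    have "(\<lambda>p. f (fst p)) \<in> borel_measurable (?H n \<Otimes>\<^sub>M ?U)"
      by (rule measurable_compose[OF measurable_fst f])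
    from int_act[OF this] have "(\<integral>\<^sup>+\<omega>. f (history_of \<omega> n) \<partial>P) =
       (\<integral>\<^sup>+\<omega>. \<integral>\<^sup>+y. \<integral>\<^sup>+u. f (\<omega>, y) \<partial>\<kappa> n (\<omega>, y) \<partial>next_law n \<omega> \<partial>\<mu> n)" by simp
    also have "\<dots> = (\<integral>\<^sup>+\<omega>. \<integral>\<^sup>+y. f (\<omega>, y) \<partial>next_law n \<omega> \<partial>\<mu> n)"
      using prob_space.emeasure_space_1[OF \<kappa>_prob] by (intro nn_integral_cong) simp
    finally show ?thesis .
  qed
  have law_of_history: "distr P (?H n) (\<lambda>\<omega>. history_of \<omega> n) = hist_law n (\<mu> n)" for n
  proof (rule measure_eqI)
    show "sets (distr P (?H n) (\<lambda>\<omega>. history_of \<omega> n)) = sets (hist_law n (\<mu> n))"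
      using sets_bind'[OF \<mu> hist_kernel] by (simp add: hist_law_def)
    fix A assume "A \<in> sets (distr P (?H n) (\<lambda>\<omega>. history_of \<omega> n))"
    then have A: "A \<in> sets (?H n)" by simp
    have "emeasure (distr P (?H n) (\<lambda>\<omega>. history_of \<omega> n)) A =
        (\<integral>\<^sup>+h. indicator A h \<partial>distr P (?H n) (\<lambda>\<omega>. history_of \<omega> n))"
      using A by simp
    also have "\<dots> = (\<integral>\<^sup>+\<omega>. indicator A (history_of \<omega> n) \<partial>P)"
      using A by (intro nn_integral_distr hist_meas) simp
    also have "\<dots> = (\<integral>\<^sup>+\<omega>. \<integral>\<^sup>+y. indicator A (\<omega>, y) \<partial>next_law n \<omega> \<partial>\<mu> n)"
      using A by (intro int_hist) simp
    also have "\<dots> = (\<integral>\<^sup>+\<omega>. emeasure (distr (next_law n \<omega>) (?H n) (Pair \<omega>)) A \<partial>\<mu> n)"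
    proof (rule nn_integral_cong)
      fix \<omega> assume \<omega>: "\<omega> \<in> space (\<mu> n)"
      then have N: "sets (next_law n \<omega>) = sets ?X"
        using measurable_space[OF next_law, of \<omega> n] by (simp add: space_prob_algebra space_\<mu>)
      have "Pair \<omega> \<in> next_law n \<omega> \<rightarrow>\<^sub>M ?H n"
        using \<omega> unfolding measurable_cong_sets[OF N refl] H by (intro measurable_Pair1')
          (simp add: space_\<mu>)
      from nn_integral_distr[OF this, of "indicator A"] A
      show "(\<integral>\<^sup>+y. indicator A (\<omega>, y) \<partial>next_law n \<omega>) =
          emeasure (distr (next_law n \<omega>) (?H n) (Pair \<omega>)) A"
        by simp
    qed
    also have "\<dots> = emeasure (hist_law n (\<mu> n)) A"
      unfolding hist_law_def by (rule emeasure_bind_prob_algebra[OF \<mu> hist_kernel A, symmetric])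
    finally show "emeasure (distr P (?H n) (\<lambda>\<omega>. history_of \<omega> n)) A =
        emeasure (hist_law n (\<mu> n)) A" .
  qed
  have AE_\<kappa>: "AE \<omega> in P. \<kappa> n (history_of \<omega> n) = \<pi> n (history_of \<omega> n)" for n
    using \<kappa>\<pi>[of n] unfolding law_of_history[symmetric] by (rule AE_distrD[OF hist_meas])
  have "AE \<omega> in P. state_at \<omega> 0 = x"
  proof -
    have sing: "{x} \<in> sets ?X" using cdt_MP_D(1)[OF D] x by (rule singleton_sets_borel_of)
    \<comment> \<open>The event that the initial state differs from \<open>x\<close>, written as a function of the history.\<close>
    let ?f = "\<lambda>h. indicator (space ?X - {x}) (snd h) :: ennreal"
    have f: "?f \<in> borel_measurable (?H 0)"
      using sets.compl_sets[OF sing] unfolding H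
      by (intro measurable_compose[OF measurable_snd] borel_measurable_indicator) auto
    have "(\<integral>\<^sup>+\<omega>. ?f (history_of \<omega> 0) \<partial>P) =
        (\<integral>\<^sup>+\<omega>. \<integral>\<^sup>+y. indicator (space ?X - {x}) y \<partial>return ?X x \<partial>\<mu> 0)"
      using int_hist[OF f] by (simp add: next_law_def)
    also have "\<dots> = 0"
      using sing x sets.compl_sets[OF sing] by (subst nn_integral_return) auto
    finally have "AE \<omega> in P. ?f (history_of \<omega> 0) = 0"
      using measurable_compose[OF hist_meas f] by (simp add: nn_integral_0_iff_AE)
    then show ?thesis
    proof (rule AE_mp, intro AE_I2 impI)
      fix \<omega> assume "\<omega> \<in> space P" and 0: "?f (history_of \<omega> 0) = 0"
      then have "state_at \<omega> 0 \<in> space ?X"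
        using measurable_space[OF measurable_state_at] sets_eq_imp_space_eq[OF sP] by metis
      with 0 show "state_at \<omega> 0 = x" by (auto simp: history_of_def indicator_def split: if_splits)
    qed
  qed
  moreover have "emeasure P {\<omega> \<in> space P. history_of \<omega> n \<in> A \<and> action_at \<omega> n \<in> B} =
        (\<integral>\<^sup>+\<omega>. indicator A (history_of \<omega> n) * emeasure (\<pi> n (history_of \<omega> n)) B \<partial>completion P)"
    if A: "A \<in> sets (?H n)" and B: "B \<in> sets ?U" for n A B
  proof -
    let ?f = "\<lambda>h. indicator A h * emeasure (\<kappa> n h) B"
    have f: "?f \<in> borel_measurable (?H n)"
      using A measurable_emeasure_kernel[OF measurable_prob_algebraD[OF \<kappa>] B]
      by (intro borel_measurable_times_ennreal) auto
    have "{\<omega> \<in> space P. history_of \<omega> n \<in> A \<and> action_at \<omega> n \<in> B} =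
        (\<lambda>\<omega>. (history_of \<omega> n, action_at \<omega> n)) -` (A \<times> B) \<inter> space P" by auto
    also have "emeasure P \<dots> = (\<integral>\<^sup>+\<omega>. indicator (A \<times> B) (history_of \<omega> n, action_at \<omega> n) \<partial>P)"
    proof -
      have "(\<lambda>\<omega>. (history_of \<omega> n, action_at \<omega> n)) -` (A \<times> B) \<inter> space P \<in> sets P"
        using A B hist_meas act_meas
        by (intro measurable_sets[where A="?H n \<Otimes>\<^sub>M ?U"] measurable_Pair pair_measureI) auto
      from nn_integral_indicator[OF this, symmetric] show ?thesis
        by (auto intro!: nn_integral_cong simp: indicator_def)
    qed
    also have "\<dots> = (\<integral>\<^sup>+\<omega>. \<integral>\<^sup>+y. \<integral>\<^sup>+u. indicator (A \<times> B) ((\<omega>, y), u) \<partial>\<kappa> n (\<omega>, y) \<partial>next_law n \<omega> \<partial>\<mu> n)"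
      using A B by (intro int_act) simp
    also have "\<dots> = (\<integral>\<^sup>+\<omega>. \<integral>\<^sup>+y. ?f (\<omega>, y) \<partial>next_law n \<omega> \<partial>\<mu> n)"
    proof (intro nn_integral_cong)
      fix \<omega> y assume w: "\<omega> \<in> space (\<mu> n)" "y \<in> space (next_law n \<omega>)"
      have "sets (next_law n \<omega>) = sets ?X"
        using measurable_space[OF next_law, of \<omega> n] w by (simp add: space_prob_algebra space_\<mu>)
      with w have "y \<in> space ?X" by (auto dest: sets_eq_imp_space_eq)
      with w measurable_space[OF \<kappa>, of "(\<omega>, y)" n] have "B \<in> sets (\<kappa> n (\<omega>, y))"
        using B by (simp add: space_prob_algebra H space_pair_measure space_\<mu>)
      then show "(\<integral>\<^sup>+u. indicator (A \<times> B) ((\<omega>, y), u) \<partial>\<kappa> n (\<omega>, y)) = ?f (\<omega>, y)"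
        by (simp add: indicator_times nn_integral_cmult)
    qed
    also have "\<dots> = (\<integral>\<^sup>+\<omega>. ?f (history_of \<omega> n) \<partial>P)" using int_hist[OF f] by simp
    also have "\<dots> = (\<integral>\<^sup>+\<omega>. indicator A (history_of \<omega> n) * emeasure (\<pi> n (history_of \<omega> n)) B \<partial>P)"
      by (rule nn_integral_cong_AE) (use AE_\<kappa>[of n] in \<open>eventually_elim, simp\<close>)
    finally show ?thesis by (simp add: nn_integral_completion)
  qed
  moreover have "emeasure P {\<omega> \<in> space P. (history_of \<omega> n, action_at \<omega> n) \<in> A \<and>
      state_at \<omega> (Suc n) \<in> B} =
        (\<integral>\<^sup>+\<omega>. indicator A (history_of \<omega> n, action_at \<omega> n) *
                emeasure (kernel D (state_at \<omega> n, action_at \<omega> n)) B \<partial>P)"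
    if A: "A \<in> sets (?H n \<Otimes>\<^sub>M ?U)" and B: "B \<in> sets ?X" for n A B
  proof -
    \<comment> \<open>Recovers \<open>(history_of \<omega> n, action_at \<omega> n)\<close> from the first \<open>n + 1\<close> steps.\<close>
    let ?e = "\<lambda>\<omega> :: ('x, 'u) path. ((restrict \<omega> {..<n}, fst (\<omega> n)), snd (\<omega> n))"
    have e: "?e \<in> ?\<Omega> (Suc n) \<rightarrow>\<^sub>M ?H n \<Otimes>\<^sub>M ?U"
    proof -
      have c: "(\<lambda>\<omega>. \<omega> n) \<in> ?\<Omega> (Suc n) \<rightarrow>\<^sub>M ?Z" by (rule measurable_component_singleton) simp
      show ?thesis unfolding H
        by (intro measurable_Pair measurable_restrict_subset measurable_compose[OF c]) auto
    qed
    let ?f = "\<lambda>h :: ('x, 'u) history. indicator A (?e (fst h)) * indicator B (snd h) :: ennreal"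
    have f: "?f \<in> borel_measurable (?H (Suc n))"
      unfolding H[of "Suc n"] using A B
      by (intro borel_measurable_times_ennreal measurable_compose[OF measurable_fst]
        measurable_compose[OF e]
          measurable_compose[OF measurable_snd]) auto
    have ev: "?e (restrict \<omega> {..<Suc n}) = (history_of \<omega> n, action_at \<omega> n)" for \<omega>
      by (simp add: history_of_def state_at_def action_at_def min_def Int_absorb1 subset_iff)
    have "{\<omega> \<in> space P. (history_of \<omega> n, action_at \<omega> n) \<in> A \<and> state_at \<omega> (Suc n) \<in> B} \<in>
        sets P" (is "?S \<in> _")
    proof -
      have "?S = ((\<lambda>\<omega>. (history_of \<omega> n, action_at \<omega> n)) -` A \<inter> space P) \<inter>
          ((\<lambda>\<omega>. state_at \<omega> (Suc n)) -` B \<inter> space P)"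
        by auto
      moreover have "(\<lambda>\<omega>. state_at \<omega> (Suc n)) \<in> P \<rightarrow>\<^sub>M ?X"
        using measurable_state_at by (simp add: measurable_cong_sets[OF sP refl])
      ultimately show ?thesis
        using measurable_sets[OF measurable_Pair[OF hist_meas act_meas] A] measurable_sets B by auto
    qed
    from nn_integral_indicator[OF this, symmetric]
    have "emeasure P ?S = (\<integral>\<^sup>+\<omega>. ?f (history_of \<omega> (Suc n)) \<partial>P)"
    proof (rule trans)
      show "(\<integral>\<^sup>+\<omega>. indicator ?S \<omega> \<partial>P) = (\<integral>\<^sup>+\<omega>. ?f (history_of \<omega> (Suc n)) \<partial>P)"
        using ev by (intro nn_integral_cong) (auto simp: history_of_def[of _ "Suc n"] indicator_def)
    qed
    also have "\<dots> = (\<integral>\<^sup>+\<omega>. \<integral>\<^sup>+y. ?f (\<omega>, y) \<partial>kernel D (\<omega> n) \<partial>\<mu> (Suc n))"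
      using int_hist[OF f] by (simp add: next_law_def)
    also have "\<dots> = (\<integral>\<^sup>+\<omega>. indicator A (?e \<omega>) * emeasure (kernel D (\<omega> n)) B \<partial>\<mu> (Suc n))"
    proof (rule nn_integral_cong)
      fix \<omega> assume "\<omega> \<in> space (\<mu> (Suc n))"
      then have "B \<in> sets (kernel D (\<omega> n))"
        using measurable_space[OF next_law, of \<omega> "Suc n"] B
          by (simp add: space_prob_algebra space_\<mu> next_law_def)
      then show "(\<integral>\<^sup>+y. ?f (\<omega>, y) \<partial>kernel D (\<omega> n)) = indicator A (?e \<omega>) *
          emeasure (kernel D (\<omega> n)) B"
        by (simp add: nn_integral_cmult)
    qed
    also have "\<dots> = (\<integral>\<^sup>+\<omega>. indicator A (?e (restrict \<omega> {..<Suc n})) *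
        emeasure (kernel D (restrict \<omega> {..<Suc n} n)) B \<partial>P)"
    proof -
      have "(\<lambda>\<omega>. kernel D (\<omega> n)) \<in> ?\<Omega> (Suc n) \<rightarrow>\<^sub>M prob_algebra ?X"
        using next_law[of "Suc n"] by (simp add: next_law_def[abs_def])
      from measurable_emeasure_kernel[OF measurable_prob_algebraD[OF this] B]
      have "(\<lambda>\<omega>. indicator A (?e \<omega>) * emeasure (kernel D (\<omega> n)) B) \<in> borel_measurable (?\<Omega> (Suc n))"
        using A by (intro borel_measurable_times_ennreal measurable_compose[OF e]) auto
      then show ?thesis
        unfolding \<mu>_def by (subst nn_integral_distr[OF restr]) simp_all
    qed
    also have "\<dots> = (\<integral>\<^sup>+\<omega>. indicator A (history_of \<omega> n, action_at \<omega> n) *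
                emeasure (kernel D (state_at \<omega> n, action_at \<omega> n)) B \<partial>P)"
      unfolding ev by (simp add: state_at_def action_at_def)
    finally show ?thesis .
  qed
  ultimately show ?thesis unfolding is_path_law_def using Pp by blast
qed

section \<open>Uniqueness of path laws\<close>

text \<open>
The change of variables formula persists for functions that are measurable only for the completion,
since they agree almost surely with measurable ones.
\<close>

lemma nn_integral_distr_completion:
  assumes h: "h \<in> P \<rightarrow>\<^sub>M N" and f: "f \<in> borel_measurable (completion (distr P N h))"
  shows "(\<integral>\<^sup>+\<omega>. f (h \<omega>) \<partial>P) = (\<integral>\<^sup>+y. f y \<partial>distr P N h)"
proof -
  obtain g where g: "g \<in> borel_measurable (distr P N h)" and AE: "AE y in distr P N h. f y = g y"
    using completion_ex_borel_measurable[OF f] by blast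
  have "(\<integral>\<^sup>+\<omega>. f (h \<omega>) \<partial>P) = (\<integral>\<^sup>+\<omega>. g (h \<omega>) \<partial>P)"
    using AE_distrD[OF h AE] by (rule nn_integral_cong_AE)
  also have "\<dots> = (\<integral>\<^sup>+y. g y \<partial>distr P N h)"
    using g by (intro nn_integral_distr[symmetric] h) simp
  also have "\<dots> = (\<integral>\<^sup>+y. f y \<partial>distr P N h)"
    using AE by (intro nn_integral_cong_AE) auto
  finally show ?thesis .
qed

text \<open>
The rectangles are stable under intersections and generate the product sigma-algebra.
\<close>

lemma prob_algebra_pair_eqI:
  assumes M: "M \<in> space (prob_algebra (A \<Otimes>\<^sub>M B))" and M': "M' \<in> space (prob_algebra (A \<Otimes>\<^sub>M B))"
    and eq: "\<And>a b. a \<in> sets A \<Longrightarrow> b \<in> sets B \<Longrightarrow> emeasure M (a \<times> b) = emeasure M' (a \<times> b)"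
  shows "M = M'"
proof (rule measure_eqI_generator_eq[OF Int_stable_pair_measure_generator[of A B]
  pair_measure_closed])
  show "sets M = sigma_sets (space A \<times> space B) {a \<times> b |a b. a \<in> sets A \<and> b \<in> sets B}"
    "sets M' = sigma_sets (space A \<times> space B) {a \<times> b |a b. a \<in> sets A \<and> b \<in> sets B}"
    using M M' by (simp_all add: space_prob_algebra sets_pair_measure)
  show "range (\<lambda>_. space A \<times> space B) \<subseteq> {a \<times> b |a b. a \<in> sets A \<and> b \<in> sets B}" by auto
  show "emeasure M (space A \<times> space B) \<noteq> \<infinity>"
    using in_space_prob_algebra[OF M] by (simp add: space_pair_measure)
qed (use eq in auto)

text \<open>
The law of the history \<open>h\<^sub>n\<close> determines the law of \<open>(h\<^sub>n, u\<^sub>n)\<close> on rectangles through \<open>\<pi>\<close>, and this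
determines the law of \<open>(h\<^sub>n, u\<^sub>n, x\<^sub>n\<^sub>+\<^sub>1)\<close> through the kernel of \<open>D\<close>. So all histories have the same
law, and every cylinder set of paths is an event about some history.
\<close>

theorem path_law_unique:
  fixes D :: "('x, 'u) mp"
  assumes T: "kernel D \<in> (state_algebra D \<Otimes>\<^sub>M action_algebra D) \<rightarrow>\<^sub>M prob_algebra (state_algebra D)"
    and \<pi>: "\<And>n. \<pi> n \<in> univ_completion (history_algebra D n) \<rightarrow>\<^sub>M prob_algebra (action_algebra D)"
    and P: "is_path_law D \<pi> x P" and P': "is_path_law D \<pi> x P'"
  shows "P = P'"
proof -
  let ?X = "state_algebra D" and ?U = "action_algebra D"
  let ?Z = "?X \<Otimes>\<^sub>M ?U" and ?H = "history_algebra D"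
  let ?\<Omega> = "\<lambda>n::nat. \<Pi>\<^sub>M i\<in>{..<n}. ?Z"
  define hist where "hist n R = distr R (?H n) (\<lambda>\<omega>. history_of \<omega> n)" for n
    and R :: "('x, 'u) path measure"
  define hist_act where "hist_act n R = distr R (?H n \<Otimes>\<^sub>M ?U) (\<lambda>\<omega>. (history_of \<omega> n, action_at \<omega> n))"
    for n and R :: "('x, 'u) path measure"
  define hist_next where "hist_next n R =
      distr R ((?H n \<Otimes>\<^sub>M ?U) \<Otimes>\<^sub>M ?X) (\<lambda>\<omega>. ((history_of \<omega> n, action_at \<omega> n), state_at \<omega> (Suc n)))"
    for n and R :: "('x, 'u) path measure"
  have sets_R: "sets R = sets (path_algebra D)" and prob_R: "prob_space R"
    if "is_path_law D \<pi> x R" for R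
    using that by (simp_all add: is_path_law_def space_prob_algebra)
  have hm: "(\<lambda>\<omega>. history_of \<omega> n) \<in> R \<rightarrow>\<^sub>M ?H n"
    and ham: "(\<lambda>\<omega>. (history_of \<omega> n, action_at \<omega> n)) \<in> R \<rightarrow>\<^sub>M ?H n \<Otimes>\<^sub>M ?U"
    and hnm: "(\<lambda>\<omega>. ((history_of \<omega> n, action_at \<omega> n), state_at \<omega> (Suc n))) \<in> R \<rightarrow>\<^sub>M
        (?H n \<Otimes>\<^sub>M ?U) \<Otimes>\<^sub>M ?X"
    if "is_path_law D \<pi> x R" for R n
    unfolding measurable_cong_sets[OF sets_R[OF that] refl]
    by (intro measurable_Pair measurable_history_of measurable_action_at measurable_state_at)+
  have hist_prob: "hist n R \<in> space (prob_algebra (?H n))"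
    and hist_act_prob: "hist_act n R \<in> space (prob_algebra (?H n \<Otimes>\<^sub>M ?U))"
    and hist_next_prob: "hist_next n R \<in> space (prob_algebra ((?H n \<Otimes>\<^sub>M ?U) \<Otimes>\<^sub>M ?X))"
    if R: "is_path_law D \<pi> x R" for R n
    unfolding hist_def hist_act_def hist_next_def space_prob_algebra
    by (simp_all add: prob_space.prob_space_distr[OF prob_R[OF R]] hm[OF R] ham[OF R] hnm[OF R])
  have hist_0: "emeasure (hist 0 R) A = indicator A (\<lambda>_. undefined, x)"
    if R: "is_path_law D \<pi> x R" and A: "A \<in> sets (?H 0)" for R A
  proof -
    interpret R: prob_space R by (rule prob_R[OF R])
    have start: "AE \<omega> in R. state_at \<omega> 0 = x" using R by (simp add: is_path_law_def)
    have "emeasure (hist 0 R) A = (\<integral>\<^sup>+h. indicator A h \<partial>hist 0 R)" using A by (simp add: hist_def)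
    also have "\<dots> = (\<integral>\<^sup>+\<omega>. indicator A (history_of \<omega> 0) \<partial>R)"
      unfolding hist_def using A by (intro nn_integral_distr hm[OF R]) simp
    also have "\<dots> = (\<integral>\<^sup>+\<omega>. indicator A (\<lambda>_. undefined, x) \<partial>R)"
      by (rule nn_integral_cong_AE) (use start in \<open>eventually_elim, simp add: history_of_def
        restrict_def\<close>)
    also have "\<dots> = indicator A (\<lambda>_. undefined, x)" by (simp add: R.emeasure_space_1)
    finally show ?thesis .
  qed
  have hist_act_rect: "emeasure (hist_act n R) (A \<times> B) = (\<integral>\<^sup>+h. indicator A h *
      emeasure (\<pi> n h) B \<partial>hist n R)"
    if R: "is_path_law D \<pi> x R" and A: "A \<in> sets (?H n)" and B: "B \<in> sets ?U" for n R A B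
  proof -
    have "emeasure (hist_act n R) (A \<times> B) = emeasure R {\<omega> \<in> space R. history_of \<omega> n \<in> A \<and>
        action_at \<omega> n \<in> B}"
      unfolding hist_act_def using A B
      by (subst emeasure_distr[OF ham[OF R]]) (auto intro!: arg_cong[where f="emeasure R"])
    also have "\<dots> = (\<integral>\<^sup>+\<omega>. indicator A (history_of \<omega> n) * emeasure (\<pi> n (history_of \<omega> n)) B \<partial>R)"
      using R A B by (simp add: is_path_law_def nn_integral_completion)
    also have "\<dots> = (\<integral>\<^sup>+h. indicator A h * emeasure (\<pi> n h) B \<partial>hist n R)"
      unfolding hist_def
    proof (rule nn_integral_distr_completion[OF hm[OF R], of "\<lambda>h. indicator A h *
        emeasure (\<pi> n h) B"])
      have "\<pi> n \<in> completion (hist n R) \<rightarrow>\<^sub>M prob_algebra ?U"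
        by (rule measurable_univ_completion_imp_completion[OF \<pi> hist_prob[OF R]])
      from measurable_emeasure_kernel[OF measurable_prob_algebraD[OF this] B] A
      show "(\<lambda>h. indicator A h * emeasure (\<pi> n h) B) \<in>
          borel_measurable (completion (distr R (?H n) (\<lambda>\<omega>. history_of \<omega> n)))"
        unfolding hist_def by (intro borel_measurable_times_ennreal borel_measurable_indicator) auto
    qed
    finally show ?thesis .
  qed
  have hist_next_rect: "emeasure (hist_next n R) (A \<times> B) =
      (\<integral>\<^sup>+p. indicator A p * emeasure (kernel D (snd (fst p), snd p)) B \<partial>hist_act n R)"
    if R: "is_path_law D \<pi> x R" and A: "A \<in> sets (?H n \<Otimes>\<^sub>M ?U)" and B: "B \<in> sets ?X" for n R A B
  proof -
    have "emeasure (hist_next n R) (A \<times> B) =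
        emeasure R {\<omega> \<in> space R. (history_of \<omega> n, action_at \<omega> n) \<in> A \<and> state_at \<omega> (Suc n) \<in> B}"
      unfolding hist_next_def using A B
      by (subst emeasure_distr[OF hnm[OF R]]) (auto intro!: arg_cong[where f="emeasure R"])
    also have "\<dots> = (\<integral>\<^sup>+\<omega>. indicator A (history_of \<omega> n, action_at \<omega> n) *
        emeasure (kernel D (snd (history_of \<omega> n), action_at \<omega> n)) B \<partial>R)"
      using R A B by (simp add: is_path_law_def history_of_def)
    also have "\<dots> = (\<integral>\<^sup>+p. indicator A p * emeasure (kernel D (snd (fst p), snd p)) B \<partial>hist_act n R)"
    proof -
      have "(\<lambda>p. kernel D (snd (fst p), snd p)) \<in> ?H n \<Otimes>\<^sub>M ?U \<rightarrow>\<^sub>M prob_algebra ?X"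
        unfolding history_algebra_def by (intro measurable_compose[OF _ T]) simp
      from measurable_emeasure_kernel[OF measurable_prob_algebraD[OF this] B]
      show ?thesis unfolding hist_act_def using A
        by (subst nn_integral_distr[OF ham[OF R]]) auto
    qed
    finally show ?thesis .
  qed
  \<comment> \<open>Assembles the history of length \<open>n + 1\<close> from that of length \<open>n\<close>, the action and the next state.\<close>
  let ?glue = "\<lambda>n p. (fun_upd (fst (fst (fst p))) n (snd (fst (fst p)), snd (fst p)), snd p) ::
      ('x, 'u) history"
  have glue: "?glue n \<in> (?H n \<Otimes>\<^sub>M ?U) \<Otimes>\<^sub>M ?X \<rightarrow>\<^sub>M ?H (Suc n)" for n
    unfolding history_algebra_def
    by (intro measurable_Pair measurable_fun_upd[where J="{..<n}"]) auto
  have hist_Suc: "hist (Suc n) R = distr (hist_next n R) (?H (Suc n)) (?glue n)"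
    if R: "is_path_law D \<pi> x R" for n R
  proof -
    have "(?glue n \<circ> (\<lambda>\<omega>. ((history_of \<omega> n, action_at \<omega> n), state_at \<omega> (Suc n)))) =
        (\<lambda>\<omega>. history_of \<omega> (Suc n))"
      by (auto simp: fun_eq_iff history_of_def state_at_def action_at_def restrict_def)
    then show ?thesis
      unfolding hist_def hist_next_def by (subst distr_distr[OF glue hnm[OF R]]) simp
  qed
  have eq: "hist n P = hist n P'" for n
  proof (induction n)
    case 0
    show ?case
      by (rule measure_eqI) (use hist_0 P P' in \<open>auto simp: hist_def\<close>)
  next
    case (Suc n)
    have "hist_act n P = hist_act n P'"
      by (rule prob_algebra_pair_eqI[OF hist_act_prob[OF P] hist_act_prob[OF P']])
        (simp add: hist_act_rect P P' Suc)
    then have "hist_next n P = hist_next n P'"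
      by (intro prob_algebra_pair_eqI[OF hist_next_prob[OF P] hist_next_prob[OF P']])
        (simp add: hist_next_rect P P')
    then show ?case by (simp add: hist_Suc P P')
  qed
  show ?thesis
  proof (rule measure_eqI_PiM_infinite[where I=UNIV and M="\<lambda>_. ?Z"])
    show "sets P = sets (PiM UNIV (\<lambda>_. ?Z))" "sets P' = sets (PiM UNIV (\<lambda>_. ?Z))"
      using sets_R P P' by (auto simp: path_algebra_def)
    show "finite_measure P" using prob_R[OF P] by (rule prob_space.finite_measure)
    fix A and J :: "nat set" assume J: "finite J" and A: "\<And>i. i \<in> J \<Longrightarrow> A i \<in> sets ?Z"
    obtain n where n: "J \<subseteq> {..<n}" using finite_nat_bounded[OF J] by blast
    let ?Y = "prod_emb {..<n} (\<lambda>_. ?Z) J (Pi\<^sub>E J A)"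
    have "?Y \<in> sets (?\<Omega> n)" using J A n by (intro sets_PiM_I) auto
    then have Y: "?Y \<times> space ?X \<in> sets (?H n)"
      unfolding history_algebra_def by (rule pair_measureI[OF _ sets.top])
    have "emeasure R (prod_emb UNIV (\<lambda>_. ?Z) J (Pi\<^sub>E J A)) = emeasure (hist n R) (?Y \<times> space ?X)"
      if R: "is_path_law D \<pi> x R" for R
    proof -
      have sp: "space R = space (PiM UNIV (\<lambda>_. ?Z))"
        using sets_eq_imp_space_eq[OF sets_R[OF R]] by (simp add: path_algebra_def)
      have "state_at \<omega> n \<in> space ?X" if "\<omega> \<in> space R" for \<omega>
        using measurable_space[OF hm[OF R] that, of n]
          by (simp add: space_history_algebra history_of_def)
      then have "(\<lambda>\<omega>. history_of \<omega> n) -` (?Y \<times> space ?X) \<inter> space R =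
          prod_emb UNIV (\<lambda>_. ?Z) {..<n} ?Y"
        unfolding prod_emb_def[of UNIV _ "{..<n}"] sp by (auto simp: history_of_def space_PiM)
      also have "\<dots> = prod_emb UNIV (\<lambda>_. ?Z) J (Pi\<^sub>E J A)"
        using n by (intro prod_emb_trans) auto
      finally show ?thesis
        unfolding hist_def by (subst emeasure_distr[OF hm[OF R] Y]) simp
    qed
    then show "emeasure P (prod_emb UNIV (\<lambda>_. ?Z) J (Pi\<^sub>E J A)) =
        emeasure P' (prod_emb UNIV (\<lambda>_. ?Z) J (Pi\<^sub>E J A))"
      using P P' eq by simp
  qed
qed

lemma path_law_eqI:
  assumes "kernel D \<in> (state_algebra D \<Otimes>\<^sub>M action_algebra D) \<rightarrow>\<^sub>M prob_algebra (state_algebra D)"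
    and "\<pi> \<in> policies D" and "is_path_law D \<pi> x P"
  shows "path_law D \<pi> x = P"
  unfolding path_law_def using assms
  by (intro the_equality) (auto simp: policies_def intro: path_law_unique)

lemma is_path_law_path_law:
  assumes "cdt_MP D" "\<pi> \<in> policies D" "x \<in> topspace (states D)"
  shows "is_path_law D \<pi> x (path_law D \<pi> x)"
  using path_law_exists[OF assms] path_law_eqI[OF cdt_MP_D(5)[OF assms(1)] assms(2)] by metis

section \<open>The state space and kernel of the auxiliary process\<close>

lemma prob_algebra_cong: "sets M = sets N \<Longrightarrow> prob_algebra M = prob_algebra N"
  using subprob_algebra_cong[of M N] by (simp only: prob_algebra_def)

abbreviation mode_algebra :: "mode measure" where
  "mode_algebra \<equiv> borel_of (discrete_topology UNIV)"

lemma UNIV_mode: "UNIV = {QS, QF}"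
  using mode.exhaust by auto

lemma sets_mode_algebra: "sets mode_algebra = UNIV"
  using openin_sets_borel_of[of "discrete_topology (UNIV :: mode set)"] by auto

lemma measurable_mode_algebraI: "f \<in> M \<rightarrow>\<^sub>M count_space UNIV \<Longrightarrow> f \<in> M \<rightarrow>\<^sub>M mode_algebra"
  by (subst measurable_cong_sets[of M M _ "count_space UNIV"]) (auto simp: sets_mode_algebra)

text \<open>
An open set of the product is the union of its two open slices, one for each mode.
\<close>

lemma sets_borel_of_prod_mode:
  "sets (borel_of (prod_topology X (discrete_topology (UNIV :: mode set)))) =
      sets (borel_of X \<Otimes>\<^sub>M mode_algebra)"
  (is "sets ?A = sets ?B")
proof
  have "W \<in> sets ?B" if W: "openin (prod_topology X (discrete_topology (UNIV :: mode set))) W" for W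
  proof -
    have slice: "{x \<in> topspace X. (x, m) \<in> W} \<times> {m} \<in> sets ?B" for m
    proof -
      have "continuous_map X (prod_topology X (discrete_topology UNIV)) (\<lambda>x. (x, m))"
        by (intro continuous_map_pairedI) auto
      from openin_continuous_map_preimage[OF this W] show ?thesis
        by (intro pair_measureI openin_sets_borel_of) (auto simp: sets_mode_algebra)
    qed
    have "W = (\<Union>m\<in>UNIV. {x \<in> topspace X. (x, m) \<in> W} \<times> {m})"
      using openin_subset[OF W] by auto
    also have "\<dots> \<in> sets ?B"
      using slice by (intro sets.finite_UN) (auto simp: UNIV_mode)
    finally show ?thesis .
  qed
  moreover have "topspace (prod_topology X (discrete_topology (UNIV :: mode set))) = space ?B"
    by (simp add: space_pair_measure)
  ultimately show "sets ?A \<subseteq> sets ?B"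
    unfolding sets_borel_of[of "prod_topology X (discrete_topology (UNIV :: mode set))"]
    by (metis (mono_tags, lifting) mem_Collect_eq sets.sigma_sets_subset subsetI)
next
  have "fst \<in> ?A \<rightarrow>\<^sub>M borel_of X"
  proof (rule measurable_borel_ofI)
    fix V assume "openin X V"
    then have "openin (prod_topology X (discrete_topology UNIV)) (V \<times> (UNIV :: mode set))"
      by (simp add: openin_prod_Times_iff)
    moreover have "fst -` V \<inter> space ?A = V \<times> UNIV" using openin_subset[OF \<open>openin X V\<close>] by auto
    ultimately show "fst -` V \<inter> space ?A \<in> sets ?A" by (metis openin_sets_borel_of)
  qed auto
  moreover have "snd \<in> ?A \<rightarrow>\<^sub>M mode_algebra"
  proof (rule measurable_borel_ofI)
    fix V :: "mode set"
    have "openin (prod_topology X (discrete_topology UNIV)) (topspace X \<times> V)"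
      by (simp add: openin_prod_Times_iff)
    moreover have "snd -` V \<inter> space ?A = topspace X \<times> V" by auto
    ultimately show "snd -` V \<inter> space ?A \<in> sets ?A" by (metis openin_sets_borel_of)
  qed auto
  ultimately have id: "(\<lambda>p. (fst p, snd p)) \<in> ?A \<rightarrow>\<^sub>M ?B" by (rule measurable_Pair)
  show "sets ?B \<subseteq> sets ?A"
  proof
    fix E assume E: "E \<in> sets ?B"
    then have "(\<lambda>p. (fst p, snd p)) -` E \<inter> space ?A = E"
      using sets.sets_into_space[OF E] by (auto simp: space_pair_measure)
    with measurable_sets[OF id E] show "E \<in> sets ?A" by simp
  qed
qed

lemma states_aux: "states (aux_MP D S) = prod_topology (states D) (discrete_topology UNIV)"
  and actions_aux: "actions (aux_MP D S) = actions D"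
  and kernel_aux: "kernel (aux_MP D S) ((x, q), u) =
      kernel D (x, u) \<Otimes>\<^sub>M return mode_algebra (mode_step S q x)"
  by (simp_all add: aux_MP_def)

lemma sets_state_algebra_aux: "sets (state_algebra (aux_MP D S)) =
    sets (state_algebra D \<Otimes>\<^sub>M mode_algebra)"
  by (simp add: states_aux sets_borel_of_prod_mode)

lemma admissible_actions_aux: "admissible_actions (aux_MP D S) (x, q) = admissible_actions D x"
  by (auto simp: admissible_actions_def aux_MP_def)

lemma sets_history_algebra_aux:
  "sets (history_algebra (aux_MP D S) n) =
     sets ((\<Pi>\<^sub>M i\<in>{..<n}. (state_algebra D \<Otimes>\<^sub>M mode_algebra) \<Otimes>\<^sub>M action_algebra D) \<Otimes>\<^sub>M
       (state_algebra D \<Otimes>\<^sub>M mode_algebra))"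
  unfolding history_algebra_def
  by (intro sets_pair_measure_cong sets_PiM_cong refl sets_state_algebra_aux) (simp_all add:
    actions_aux sets_state_algebra_aux)

lemma sets_path_algebra_aux:
  "sets (path_algebra (aux_MP D S)) =
      sets (\<Pi>\<^sub>M i\<in>UNIV. (state_algebra D \<Otimes>\<^sub>M mode_algebra) \<Otimes>\<^sub>M action_algebra D)"
  unfolding path_algebra_def
  by (intro sets_PiM_cong sets_pair_measure_cong refl sets_state_algebra_aux) (simp_all add:
    actions_aux)

lemma measurable_mode_step:
  assumes S: "S \<in> sets X" and f: "f \<in> M \<rightarrow>\<^sub>M X" and m: "m \<in> M \<rightarrow>\<^sub>M count_space UNIV"
  shows "(\<lambda>z. mode_step S (m z) (f z)) \<in> M \<rightarrow>\<^sub>M count_space UNIV"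
proof -
  have eq: "mode_step S q y = (if q = QS \<and> y \<in> S then QS else QF)" for q y
    by (cases q) auto
  have [measurable]: "Measurable.pred M (\<lambda>z. f z \<in> S)" using f S by (rule pred_sets2[rotated])
  have [measurable]: "Measurable.pred M (\<lambda>z. m z = QS)" using m by measurable
  show ?thesis unfolding eq by measurable
qed

theorem kernel_aux_measurable:
  assumes T: "kernel D \<in> (state_algebra D \<Otimes>\<^sub>M action_algebra D) \<rightarrow>\<^sub>M prob_algebra (state_algebra D)"
    and S: "S \<in> sets (state_algebra D)"
  shows "kernel (aux_MP D S) \<in> (state_algebra (aux_MP D S) \<Otimes>\<^sub>M action_algebra (aux_MP D S))
    \<rightarrow>\<^sub>M prob_algebra (state_algebra (aux_MP D S))"
proof -
  let ?M = "(state_algebra D \<Otimes>\<^sub>M mode_algebra) \<Otimes>\<^sub>M action_algebra D"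
  have id: "(\<lambda>q. q) \<in> mode_algebra \<rightarrow>\<^sub>M count_space UNIV"
    by (subst measurable_cong_sets[of _ "count_space UNIV"]) (auto simp: sets_mode_algebra)
  have "(\<lambda>p. mode_step S (snd (fst p)) (fst (fst p))) \<in> ?M \<rightarrow>\<^sub>M count_space UNIV"
    by (intro measurable_mode_step[OF S] measurable_compose[OF _ id]) simp_all
  then have "(\<lambda>p. return mode_algebra (mode_step S (snd (fst p)) (fst (fst p)))) \<in> ?M \<rightarrow>\<^sub>M
      prob_algebra mode_algebra"
    by (intro measurable_compose[OF measurable_mode_algebraI measurable_return_prob_space])
  moreover have "(\<lambda>p. kernel D (fst (fst p), snd p)) \<in> ?M \<rightarrow>\<^sub>M prob_algebra (state_algebra D)"
    by (intro measurable_compose[OF _ T]) simp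
  ultimately have "(\<lambda>p. kernel D (fst (fst p), snd p) \<Otimes>\<^sub>M return mode_algebra (mode_step S (snd
      (fst p)) (fst (fst p))))
      \<in> ?M \<rightarrow>\<^sub>M prob_algebra (state_algebra D \<Otimes>\<^sub>M mode_algebra)"
    by (rule measurable_pair_prob[rotated])
  moreover have "kernel (aux_MP D S) =
      (\<lambda>p. kernel D (fst (fst p), snd p) \<Otimes>\<^sub>M return mode_algebra (mode_step S (snd (fst p)) (fst
        (fst p))))"
    by (auto simp: aux_MP_def)
  moreover have "sets (state_algebra (aux_MP D S) \<Otimes>\<^sub>M action_algebra (aux_MP D S)) = sets ?M"
    by (intro sets_pair_measure_cong sets_state_algebra_aux) (simp add: actions_aux)
  ultimately show ?thesis
    unfolding prob_algebra_cong[OF sets_state_algebra_aux] by (simp cong: measurable_cong_sets)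
qed

text \<open>
The product with a point mass evaluates the slice at that point.
\<close>

lemma emeasure_kernel_aux:
  assumes T: "kernel D (x, u) \<in> space (prob_algebra (state_algebra D))"
    and B: "B \<in> sets (state_algebra (aux_MP D S))"
  shows "emeasure (kernel (aux_MP D S) ((x, q), u)) B =
    emeasure (kernel D (x, u)) {y \<in> topspace (states D). (y, mode_step S q x) \<in> B}"
proof -
  let ?t = "mode_step S q x" and ?K = "kernel D (x, u)"
  interpret R: prob_space "return mode_algebra ?t" by (rule prob_space_return) simp
  have sK: "sets ?K = sets (state_algebra D)" using T by (simp add: space_prob_algebra)
  have B': "B \<in> sets (?K \<Otimes>\<^sub>M return mode_algebra ?t)"
    using B sets_pair_measure_cong[OF sK, of "return mode_algebra ?t" mode_algebra]
      by (simp add: sets_state_algebra_aux)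
  have slice: "{y \<in> topspace (states D). (y, ?t) \<in> B} = (\<lambda>y. (y, ?t)) -` B \<inter> space ?K"
    using sets_eq_imp_space_eq[OF sK] by auto
  have "(\<lambda>y. (y, ?t)) -` B \<inter> space ?K \<in> sets ?K"
    using B' by (rule measurable_sets[rotated]) (auto intro: measurable_Pair2')
  then have "emeasure ?K {y \<in> topspace (states D). (y, ?t) \<in> B} = (\<integral>\<^sup>+y. indicator {y \<in>
      topspace (states D). (y, ?t) \<in> B} y \<partial>?K)"
    unfolding slice by simp
  also have "\<dots> = (\<integral>\<^sup>+y. emeasure (return mode_algebra ?t) (Pair y -` B) \<partial>?K)"
    using sets_eq_imp_space_eq[OF sK]
    by (intro nn_integral_cong) (auto simp: sets_mode_algebra indicator_def)
  also have "\<dots> = emeasure (?K \<Otimes>\<^sub>M return mode_algebra ?t) B"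
    by (rule R.emeasure_pair_measure_alt[OF B', symmetric])
  finally show ?thesis by (simp add: kernel_aux)
qed

section \<open>Lifting paths, histories and policies\<close>

primrec mode_after :: "'x set \<Rightarrow> mode \<Rightarrow> (nat \<Rightarrow> 'x) \<Rightarrow> nat \<Rightarrow> mode" where
  "mode_after S q s 0 = q"
| "mode_after S q s (Suc n) = mode_step S (mode_after S q s n) (s n)"

lemma mode_after_cong: "(\<And>i. i < n \<Longrightarrow> s i = s' i) \<Longrightarrow> mode_after S q s n = mode_after S q s' n"
  by (induction n) auto

lemma mode_after_QF: "mode_after S QF s n = QF"
  by (induction n) auto

lemma mode_after_QS: "mode_after S QS s n = QS \<longleftrightarrow> (\<forall>i<n. s i \<in> S)"
proof (induction n)
  case (Suc n)
  then show ?case by (cases "mode_after S QS s n") (auto simp: less_Suc_eq)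
qed simp

lemma measurable_mode_after:
  assumes S: "S \<in> sets X" and s: "\<And>i. i < n \<Longrightarrow> (\<lambda>z. s z i) \<in> M \<rightarrow>\<^sub>M X"
  shows "(\<lambda>z. mode_after S q (s z) n) \<in> M \<rightarrow>\<^sub>M count_space UNIV"
  using s by (induction n) (auto intro!: measurable_mode_step[OF S])

definition lift_path :: "'x set \<Rightarrow> mode \<Rightarrow> ('x, 'u) path \<Rightarrow> ('x \<times> mode, 'u) path" where
  "lift_path S q \<omega> = (\<lambda>k. ((state_at \<omega> k, mode_after S q (state_at \<omega>) k), action_at \<omega> k))"

text \<open>
The components of a history beyond its length are undefined, both before and after the lift. This is
why the abstractions here and in \<open>forget_history\<close> are restricted to \<open>{..<n}\<close>.
\<close>

definition lift_history :: "'x set \<Rightarrow> mode \<Rightarrow> nat \<Rightarrow> ('x, 'u) history \<Rightarrow> ('x \<times> mode, 'u) history" where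
  "lift_history S q n h =
     (\<lambda>k\<in>{..<n}. ((fst (fst h k), mode_after S q (\<lambda>i. fst (fst h i)) k), snd (fst h k)),
      (snd h, mode_after S q (\<lambda>i. fst (fst h i)) n))"

definition forget_history :: "nat \<Rightarrow> ('x \<times> mode, 'u) history \<Rightarrow> ('x, 'u) history" where
  "forget_history n h = (\<lambda>k\<in>{..<n}. (fst (fst (fst h k)), snd (fst h k)), fst (snd h))"

lemma state_at_lift_path: "state_at (lift_path S q \<omega>) n =
    (state_at \<omega> n, mode_after S q (state_at \<omega>) n)"
  and action_at_lift_path: "action_at (lift_path S q \<omega>) n = action_at \<omega> n"
  by (simp_all add: lift_path_def state_at_def action_at_def)

lemma history_of_lift_path: "history_of (lift_path S q \<omega>) n = lift_history S q n (history_of \<omega> n)"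
proof -
  have "mode_after S q (state_at \<omega>) k = mode_after S q (\<lambda>i. fst (restrict \<omega> {..<n} i)) k"
    if "k \<le> n" for k
    using that by (intro mode_after_cong) (simp add: state_at_def)
  then show ?thesis
    by (auto simp: history_of_def lift_history_def lift_path_def state_at_def action_at_def
      restrict_def fun_eq_iff)
qed

lemma forget_lift_history:
  assumes "h \<in> space (history_algebra D n)"
  shows "forget_history n (lift_history S q n h) = h"
proof -
  have "fst h \<in> extensional {..<n}"
    using assms by (auto simp: space_history_algebra space_PiM PiE_iff mem_Times_iff)
  then show ?thesis
    by (cases h) (auto simp: forget_history_def lift_history_def fun_eq_iff extensional_def
      restrict_def)
qed

lemma measurable_lift_path:
  assumes S: "S \<in> sets (state_algebra D)"
  shows "lift_path S q \<in> path_algebra D \<rightarrow>\<^sub>M path_algebra (aux_MP D S)"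
  unfolding measurable_cong_sets[OF refl sets_path_algebra_aux] lift_path_def
  by (intro measurable_abs_UNIV measurable_Pair measurable_state_at measurable_action_at
      measurable_mode_algebraI measurable_mode_after[OF S])

lemma measurable_history_step:
  assumes "k < n"
  shows "(\<lambda>h. fst h k) \<in> history_algebra D n \<rightarrow>\<^sub>M state_algebra D \<Otimes>\<^sub>M action_algebra D"
  unfolding history_algebra_def using assms
  by (intro measurable_compose[OF measurable_fst] measurable_component_singleton) simp

lemma measurable_lift_history:
  assumes S: "S \<in> sets (state_algebra D)"
  shows "lift_history S q n \<in> history_algebra D n \<rightarrow>\<^sub>M history_algebra (aux_MP D S) n"
proof -
  note c = measurable_history_step[of _ n D]
  have "snd \<in> history_algebra D n \<rightarrow>\<^sub>M state_algebra D" by (simp add: history_algebra_def)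
  then show ?thesis
    unfolding measurable_cong_sets[OF refl sets_history_algebra_aux] lift_history_def[abs_def]
    by (intro measurable_Pair measurable_restrict measurable_mode_algebraI
      measurable_mode_after[OF S]
        measurable_compose[OF c measurable_fst] measurable_compose[OF c measurable_snd]) auto
qed

lemma measurable_forget_history:
  "forget_history n \<in> history_algebra (aux_MP D S) n \<rightarrow>\<^sub>M history_algebra D n"
proof -
  let ?Z = "(state_algebra D \<Otimes>\<^sub>M mode_algebra) \<Otimes>\<^sub>M action_algebra D"
  have c: "(\<lambda>h. fst h k) \<in> (\<Pi>\<^sub>M i\<in>{..<n}. ?Z) \<Otimes>\<^sub>M (state_algebra D \<Otimes>\<^sub>M mode_algebra) \<rightarrow>\<^sub>M ?Z"
    if "k < n" for k
    using that by (intro measurable_compose[OF measurable_fst] measurable_component_singleton) simp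
  have "forget_history n \<in> (\<Pi>\<^sub>M i\<in>{..<n}. ?Z) \<Otimes>\<^sub>M (state_algebra D \<Otimes>\<^sub>M mode_algebra) \<rightarrow>\<^sub>M
      history_algebra D n"
    unfolding forget_history_def[abs_def] history_algebra_def
    by (intro measurable_Pair measurable_restrict measurable_compose[OF c measurable_snd]
        measurable_compose[OF c measurable_compose[OF measurable_fst measurable_fst]]) simp_all
  then show ?thesis
    unfolding measurable_cong_sets[OF sets_history_algebra_aux refl] .
qed

text \<open>
The admissible actions do not depend on the mode, so admissibility is preserved.
\<close>

lemma forget_policy:
  assumes \<pi>: "\<pi> \<in> policies D"
  shows "(\<lambda>n h. \<pi> n (forget_history n h)) \<in> policies (aux_MP D S)"
  unfolding policies_def
proof (intro CollectI allI conjI ballI)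
  fix n
  show "(\<lambda>h. \<pi> n (forget_history n h)) \<in> univ_completion (history_algebra (aux_MP D S) n) \<rightarrow>\<^sub>M
      prob_algebra (action_algebra (aux_MP D S))"
    using \<pi> unfolding actions_aux
    by (intro measurable_compose[OF measurable_univ_completion[OF measurable_forget_history]])
      (simp add: policies_def)
  fix h assume "h \<in> space (history_algebra (aux_MP D S) n)"
  from measurable_space[OF measurable_forget_history this] \<pi>
  have "emeasure (completion (\<pi> n (forget_history n h))) (admissible_actions D (snd
      (forget_history n h))) = 1"
    by (simp add: policies_def)
  then show "emeasure (completion (\<pi> n (forget_history n h))) (admissible_actions (aux_MP D S)
      (snd h)) = 1"
    using admissible_actions_aux[of D S "fst (snd h)" "snd (snd h)"]
      by (simp add: forget_history_def)
qed

lemma lift_policy: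
  assumes \<pi>: "\<pi> \<in> policies (aux_MP D S)" and S: "S \<in> sets (state_algebra D)"
  shows "(\<lambda>n h. \<pi> n (lift_history S q n h)) \<in> policies D"
  unfolding policies_def
proof (intro CollectI allI conjI ballI)
  fix n
  show "(\<lambda>h. \<pi> n (lift_history S q n h)) \<in> univ_completion (history_algebra D n) \<rightarrow>\<^sub>M
      prob_algebra (action_algebra D)"
    using \<pi> by (intro measurable_compose[OF measurable_univ_completion[OF
      measurable_lift_history[OF S]]])
      (simp add: policies_def actions_aux)
  fix h assume "h \<in> space (history_algebra D n)"
  from measurable_space[OF measurable_lift_history[OF S] this] \<pi>
  have "emeasure (completion (\<pi> n (lift_history S q n h))) (admissible_actions (aux_MP D S) (snd
      (lift_history S q n h))) = 1"
    by (simp add: policies_def)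
  then show "emeasure (completion (\<pi> n (lift_history S q n h))) (admissible_actions D (snd h)) = 1"
    by (simp add: lift_history_def admissible_actions_aux)
qed

text \<open>
The history of a lifted path is the lift of the history. The identity for the actions is thus the one
for \<open>P\<close> with \<open>A\<close> replaced by its preimage under \<open>lift_history\<close>. In the identity for the next state, the
next mode is a function \<open>next_mode\<close> of the history. Splitting the event according to its two values
turns each part into an event about the next state of \<open>D\<close> alone.
\<close>

theorem is_path_law_lift:
  fixes D :: "('x, 'u) mp"
  assumes T: "kernel D \<in> (state_algebra D \<Otimes>\<^sub>M action_algebra D) \<rightarrow>\<^sub>M prob_algebra (state_algebra D)"
    and S: "S \<in> sets (state_algebra D)" and x: "{x} \<in> sets (state_algebra D)"
    and \<pi>': "\<pi>' \<in> policies (aux_MP D S)"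
    and agree: "\<And>n h. h \<in> space (history_algebra D n) \<Longrightarrow> \<pi> n h = \<pi>' n (lift_history S q n h)"
    and P: "is_path_law D \<pi> x P"
  shows "is_path_law (aux_MP D S) \<pi>' (x, q) (distr P (path_algebra (aux_MP D S)) (lift_path S q))"
proof -
  let ?E = "aux_MP D S" and ?X = "state_algebra D" and ?U = "action_algebra D"
  let ?L = "lift_path S q" and ?P' = "distr P (path_algebra (aux_MP D S)) (lift_path S q)"
  have sP: "sets P = sets (path_algebra D)" and prob: "prob_space P"
    and start: "AE \<omega> in P. state_at \<omega> 0 = x"
    using P by (auto simp: is_path_law_def space_prob_algebra)
  have act_law: "emeasure P {\<omega> \<in> space P. history_of \<omega> n \<in> A \<and> action_at \<omega> n \<in> B} =
      (\<integral>\<^sup>+\<omega>. indicator A (history_of \<omega> n) * emeasure (\<pi> n (history_of \<omega> n)) B \<partial>P)"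
    if "A \<in> sets (history_algebra D n)" "B \<in> sets ?U" for n A B
    using P that by (simp add: is_path_law_def nn_integral_completion)
  have spP: "space P = space (path_algebra D)" using sP by (rule sets_eq_imp_space_eq)
  have L: "?L \<in> P \<rightarrow>\<^sub>M path_algebra ?E"
    using measurable_lift_path[OF S] by (simp add: measurable_cong_sets[OF sP refl])
  have hist: "(\<lambda>\<omega>. history_of \<omega> n) \<in> P \<rightarrow>\<^sub>M history_algebra D n"
    and act: "(\<lambda>\<omega>. action_at \<omega> n) \<in> P \<rightarrow>\<^sub>M ?U" and state: "(\<lambda>\<omega>. state_at \<omega> n) \<in> P \<rightarrow>\<^sub>M ?X" for n
    using measurable_history_of measurable_action_at measurable_state_at
    by (auto simp: measurable_cong_sets[OF sP refl])
  have hist': "(\<lambda>\<omega>. history_of \<omega> n) \<in> ?P' \<rightarrow>\<^sub>M history_algebra ?E n"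
    and act': "(\<lambda>\<omega>. action_at \<omega> n) \<in> ?P' \<rightarrow>\<^sub>M action_algebra ?E"
    and state': "(\<lambda>\<omega>. state_at \<omega> n) \<in> ?P' \<rightarrow>\<^sub>M state_algebra ?E" for n
    using measurable_history_of measurable_action_at measurable_state_at by simp_all
  have prob': "prob_space ?P'" by (rule prob_space.prob_space_distr[OF prob L])
  have em: "emeasure ?P' {\<omega> \<in> space ?P'. Q \<omega>} = emeasure P {\<omega> \<in> space P. Q (?L \<omega>)}"
    if "{\<omega> \<in> space ?P'. Q \<omega>} \<in> sets ?P'" for Q
  proof -
    have "?L -` {\<omega> \<in> space ?P'. Q \<omega>} \<inter> space P = {\<omega> \<in> space P. Q (?L \<omega>)}"
      using measurable_space[OF L] by auto
    with that show ?thesis by (subst emeasure_distr[OF L]) auto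
  qed
  have "AE \<omega> in ?P'. state_at \<omega> 0 = (x, q)"
  proof -
    have "{(x, q)} = {x} \<times> {q}" by auto
    also have "\<dots> \<in> sets (state_algebra ?E)"
      unfolding sets_state_algebra_aux using x by (intro pair_measureI)
        (auto simp: sets_mode_algebra)
    finally have "(\<lambda>\<omega>. state_at \<omega> 0) -` {(x, q)} \<inter> space (path_algebra ?E) \<in> sets (path_algebra ?E)"
      by (rule measurable_sets[OF measurable_state_at])
    also have "(\<lambda>\<omega>. state_at \<omega> 0) -` {(x, q)} \<inter> space (path_algebra ?E) = {\<omega> \<in>
        space (path_algebra ?E). state_at \<omega> 0 = (x, q)}"
      by auto
    finally show ?thesis
      using start by (subst AE_distr_iff[OF L]) (auto simp: state_at_lift_path)
  qed
  moreover have "emeasure ?P' {\<omega> \<in> space ?P'. history_of \<omega> n \<in> A \<and> action_at \<omega> n \<in> B} =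
        (\<integral>\<^sup>+\<omega>. indicator A (history_of \<omega> n) * emeasure (\<pi>' n (history_of \<omega> n)) B \<partial>completion ?P')"
    if A: "A \<in> sets (history_algebra ?E n)" and B: "B \<in> sets (action_algebra ?E)" for n A B
  proof -
    let ?A = "lift_history S q n -` A \<inter> space (history_algebra D n)"
    let ?f = "\<lambda>\<omega>. indicator A (history_of \<omega> n) * emeasure (\<pi>' n (history_of \<omega> n)) B"
    have A': "?A \<in> sets (history_algebra D n)"
      by (rule measurable_sets[OF measurable_lift_history[OF S] A])
    have B': "B \<in> sets ?U" using B by (simp add: actions_aux)
    have "{\<omega> \<in> space ?P'. history_of \<omega> n \<in> A \<and> action_at \<omega> n \<in> B} =
        ((\<lambda>\<omega>. history_of \<omega> n) -` A \<inter> space ?P') \<inter> ((\<lambda>\<omega>. action_at \<omega> n) -` B \<inter> space ?P')" by auto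
    also have "\<dots> \<in> sets ?P'" using measurable_sets[OF hist' A] measurable_sets[OF act' B] by auto
    finally have "emeasure ?P' {\<omega> \<in> space ?P'. history_of \<omega> n \<in> A \<and> action_at \<omega> n \<in> B} =
        emeasure P {\<omega> \<in> space P. history_of \<omega> n \<in> ?A \<and> action_at \<omega> n \<in> B}"
      using measurable_space[OF hist] by (subst em)
        (auto intro!: arg_cong[where f="emeasure P"] simp: history_of_lift_path action_at_lift_path)
    also have "\<dots> = (\<integral>\<^sup>+\<omega>. indicator ?A (history_of \<omega> n) * emeasure (\<pi> n (history_of \<omega> n)) B \<partial>P)"
      by (rule act_law[OF A' B'])
    also have "\<dots> = (\<integral>\<^sup>+\<omega>. ?f (?L \<omega>) \<partial>P)"
      using measurable_space[OF hist[of n]]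
      by (intro nn_integral_cong) (simp add: history_of_lift_path agree indicator_def)
    also have "\<dots> = (\<integral>\<^sup>+\<omega>. ?f \<omega> \<partial>?P')"
    proof (rule nn_integral_distr_completion[OF L])
      have "(\<lambda>\<omega>. history_of \<omega> n) \<in> univ_completion (path_algebra ?E) \<rightarrow>\<^sub>M
          univ_completion (history_algebra ?E n)"
        by (rule measurable_univ_completion[OF measurable_history_of])
      moreover have "?P' \<in> space (prob_algebra (path_algebra ?E))"
        using prob' by (simp add: space_prob_algebra)
      ultimately have h: "(\<lambda>\<omega>. history_of \<omega> n) \<in> completion ?P' \<rightarrow>\<^sub>M
          univ_completion (history_algebra ?E n)"
        by (rule measurable_univ_completion_imp_completion)
      have "\<pi>' n \<in> univ_completion (history_algebra ?E n) \<rightarrow>\<^sub>M prob_algebra (action_algebra ?E)"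
        using \<pi>' by (simp add: policies_def)
      from measurable_emeasure_kernel[OF measurable_prob_algebraD[OF measurable_compose[OF h
        this]] B]
      show "?f \<in> borel_measurable (completion ?P')"
        using measurable_compose[OF h borel_measurable_indicator[OF sets_univ_completionI[OF A]]]
        by (intro borel_measurable_times_ennreal)
    qed
    finally show ?thesis by (simp add: nn_integral_completion)
  qed
  moreover have "emeasure ?P' {\<omega> \<in> space ?P'. (history_of \<omega> n, action_at \<omega> n) \<in> A \<and>
      state_at \<omega> (Suc n) \<in> B} =
        (\<integral>\<^sup>+\<omega>. indicator A (history_of \<omega> n, action_at \<omega> n) *
                emeasure (kernel ?E (state_at \<omega> n, action_at \<omega> n)) B \<partial>?P')"
    if A: "A \<in> sets (history_algebra ?E n \<Otimes>\<^sub>M action_algebra ?E)"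
      and B: "B \<in> sets (state_algebra ?E)" for n A B
  proof -
    let ?H = "history_algebra D n"
    define next_mode where "next_mode h = mode_step S (snd (snd (lift_history S q n h))) (snd h)"
      for h :: "('x, 'u) history"
    define Am where "Am m = {p \<in> space (?H \<Otimes>\<^sub>M ?U). (lift_history S q n (fst p), snd p) \<in> A \<and>
        next_mode (fst p) = m}" for m
    define Bm where "Bm m = {y \<in> topspace (states D). (y, m) \<in> B}" for m
    have next_mode: "next_mode (history_of \<omega> n) = mode_after S q (state_at \<omega>) (Suc n)" for \<omega>
      by (simp add: next_mode_def history_of_lift_path[symmetric])
        (simp add: history_of_def state_at_lift_path)
    have Bm: "Bm m \<in> sets ?X" for m
    proof -
      have "Bm m = (\<lambda>y. (y, m)) -` B \<inter> space ?X" by (auto simp: Bm_def)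
      moreover have "(\<lambda>y. (y, m)) \<in> ?X \<rightarrow>\<^sub>M ?X \<Otimes>\<^sub>M mode_algebra" by (rule measurable_Pair2') simp
      ultimately show ?thesis using measurable_sets[of "\<lambda>y. (y, m)" ?X _ B] B
        sets_state_algebra_aux by metis
    qed
    have Am: "Am m \<in> sets (?H \<Otimes>\<^sub>M ?U)" for m
    proof -
      have lift: "(\<lambda>p. (lift_history S q n (fst p), snd p)) \<in> ?H \<Otimes>\<^sub>M ?U \<rightarrow>\<^sub>M
          history_algebra ?E n \<Otimes>\<^sub>M action_algebra ?E"
        unfolding actions_aux
        by (intro measurable_Pair measurable_compose[OF measurable_fst measurable_lift_history[OF
          S]] measurable_snd)
      have c: "(\<lambda>h. fst (fst h k)) \<in> ?H \<rightarrow>\<^sub>M ?X" if "k < n" for k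
        by (rule measurable_compose[OF measurable_history_step[OF that] measurable_fst])
      have "next_mode \<in> ?H \<rightarrow>\<^sub>M count_space UNIV"
        unfolding next_mode_def[abs_def] lift_history_def snd_conv
        by (intro measurable_mode_step[OF S] measurable_mode_after[OF S] c) (simp_all add:
          history_algebra_def)
      from measurable_compose[OF measurable_fst this]
      have nm: "(\<lambda>p. next_mode (fst p)) \<in> ?H \<Otimes>\<^sub>M ?U \<rightarrow>\<^sub>M count_space UNIV" .
      have "Am m = ((\<lambda>p. (lift_history S q n (fst p), snd p)) -` A \<inter> space (?H \<Otimes>\<^sub>M ?U)) \<inter>
          ((\<lambda>p. next_mode (fst p)) -` {m} \<inter> space (?H \<Otimes>\<^sub>M ?U))" by (auto simp: Am_def)
      then show ?thesis using measurable_sets[OF lift A] measurable_sets[OF nm, of "{m}"] by auto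
    qed
    let ?V = "\<lambda>m. {\<omega> \<in> space P. (history_of \<omega> n, action_at \<omega> n) \<in> Am m \<and> state_at \<omega> (Suc n) \<in> Bm m}"
    let ?f = "\<lambda>\<omega>. indicator A (history_of \<omega> n, action_at \<omega> n) *
        emeasure (kernel ?E (state_at \<omega> n, action_at \<omega> n)) B"
    have Vm: "?V m \<in> sets P" for m
    proof -
      have "?V m = ((\<lambda>\<omega>. (history_of \<omega> n, action_at \<omega> n)) -` Am m \<inter> space P) \<inter>
          ((\<lambda>\<omega>. state_at \<omega> (Suc n)) -` Bm m \<inter> space P)"
        by auto
      then show ?thesis using measurable_sets[OF measurable_Pair[OF hist act] Am]
        measurable_sets[OF state Bm] by auto
    qed
    have ha: "(history_of \<omega> n, action_at \<omega> n) \<in> space (?H \<Otimes>\<^sub>M ?U)" if "\<omega> \<in> space P" for \<omega>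
      using measurable_space[OF measurable_Pair[OF hist act] that] .
    have st: "state_at \<omega> k \<in> topspace (states D)" if "\<omega> \<in> space P" for \<omega> k
      using measurable_space[OF state that] by simp
    have "{\<omega> \<in> space ?P'. (history_of \<omega> n, action_at \<omega> n) \<in> A \<and> state_at \<omega> (Suc n) \<in> B} =
        ((\<lambda>\<omega>. (history_of \<omega> n, action_at \<omega> n)) -` A \<inter> space ?P') \<inter> ((\<lambda>\<omega>. state_at \<omega> (Suc n)) -` B
          \<inter> space ?P')" by auto
    also have "\<dots> \<in> sets ?P'" using measurable_sets[OF measurable_Pair[OF hist' act'] A]
      measurable_sets[OF state' B] by auto
    finally have "emeasure ?P' {\<omega> \<in> space ?P'. (history_of \<omega> n, action_at \<omega> n) \<in> A \<and>
        state_at \<omega> (Suc n) \<in> B} =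
        emeasure P {\<omega> \<in> space P. (lift_history S q n (history_of \<omega> n), action_at \<omega> n) \<in> A \<and>
          (state_at \<omega> (Suc n), mode_after S q (state_at \<omega>) (Suc n)) \<in> B}"
      by (subst em) (simp_all only: history_of_lift_path action_at_lift_path state_at_lift_path)
    also have "{\<omega> \<in> space P. (lift_history S q n (history_of \<omega> n), action_at \<omega> n) \<in> A \<and>
          (state_at \<omega> (Suc n), mode_after S q (state_at \<omega>) (Suc n)) \<in> B} = ?V QS \<union> ?V QF" (is "?S
            = _")
    proof -
      have "\<omega> \<in> ?S \<longleftrightarrow> \<omega> \<in> ?V QS \<union> ?V QF" for \<omega>
        using ha[of \<omega>] st[of \<omega>]
        by (cases "mode_after S q (state_at \<omega>) (Suc n)")
          (auto simp del: mode_after.simps simp: Am_def Bm_def next_mode)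
      then show ?thesis by blast
    qed
    also have "emeasure P (?V QS \<union> ?V QF) = emeasure P (?V QS) + emeasure P (?V QF)"
      by (rule plus_emeasure[symmetric]) (use Vm in \<open>auto simp: Am_def\<close>)
    also have "\<dots> = (\<integral>\<^sup>+\<omega>. indicator (Am QS) (history_of \<omega> n, action_at \<omega> n) *
        emeasure (kernel D (state_at \<omega> n, action_at \<omega> n)) (Bm QS) \<partial>P) +
       (\<integral>\<^sup>+\<omega>. indicator (Am QF) (history_of \<omega> n, action_at \<omega> n) * emeasure (kernel D (state_at \<omega>
         n, action_at \<omega> n)) (Bm QF) \<partial>P)"
      using P Am Bm by (simp add: is_path_law_def)
    also have "\<dots> = (\<integral>\<^sup>+\<omega>. indicator (Am QS) (history_of \<omega> n, action_at \<omega> n) *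
        emeasure (kernel D (state_at \<omega> n, action_at \<omega> n)) (Bm QS) +
       indicator (Am QF) (history_of \<omega> n, action_at \<omega> n) * emeasure (kernel D (state_at \<omega> n,
         action_at \<omega> n)) (Bm QF) \<partial>P)"
    proof -
      have "(\<lambda>\<omega>. kernel D (state_at \<omega> n, action_at \<omega> n)) \<in> P \<rightarrow>\<^sub>M prob_algebra ?X"
        by (rule measurable_compose[OF measurable_Pair[OF state act] T])
      note k = measurable_emeasure_kernel[OF measurable_prob_algebraD[OF this] Bm]
      have meas: "(\<lambda>\<omega>. indicator (Am m) (history_of \<omega> n, action_at \<omega> n) *
          emeasure (kernel D (state_at \<omega> n, action_at \<omega> n)) (Bm m)) \<in> borel_measurable P" for m
        by (intro borel_measurable_times_ennreal k measurable_compose[OF measurable_Pair[OF hist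
          act]] borel_measurable_indicator Am)
      show ?thesis by (rule nn_integral_add[OF meas meas, symmetric])
    qed
    also have "\<dots> = (\<integral>\<^sup>+\<omega>. ?f (?L \<omega>) \<partial>P)"
    proof (rule nn_integral_cong)
      fix \<omega> assume \<omega>: "\<omega> \<in> space P"
      have K: "kernel D (state_at \<omega> n, action_at \<omega> n) \<in> space (prob_algebra ?X)"
        using measurable_space[OF measurable_compose[OF measurable_Pair[OF state act] T] \<omega>] .
      have "emeasure (kernel ?E (state_at (?L \<omega>) n, action_at (?L \<omega>) n)) B =
          emeasure (kernel D (state_at \<omega> n, action_at \<omega> n)) (Bm (next_mode (history_of \<omega> n)))"
        unfolding state_at_lift_path action_at_lift_path emeasure_kernel_aux[OF K B] next_mode
          Bm_def by simp
      moreover have "next_mode (history_of \<omega> n) = QS \<or> next_mode (history_of \<omega> n) = QF"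
        using mode.exhaust by blast
      ultimately show "indicator (Am QS) (history_of \<omega> n, action_at \<omega> n) *
          emeasure (kernel D (state_at \<omega> n, action_at \<omega> n)) (Bm QS) +
         indicator (Am QF) (history_of \<omega> n, action_at \<omega> n) * emeasure (kernel D (state_at \<omega> n,
           action_at \<omega> n)) (Bm QF) = ?f (?L \<omega>)"
        using ha[OF \<omega>] by (auto simp: Am_def indicator_def history_of_lift_path action_at_lift_path)
    qed
    also have "\<dots> = (\<integral>\<^sup>+\<omega>. ?f \<omega> \<partial>?P')"
    proof (rule nn_integral_distr[OF L, symmetric])
      have "(\<lambda>\<omega>. kernel ?E (state_at \<omega> n, action_at \<omega> n)) \<in> ?P' \<rightarrow>\<^sub>M prob_algebra (state_algebra ?E)"
        by (rule measurable_compose[OF measurable_Pair[OF state' act'] kernel_aux_measurable[OF T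
          S]])
      from measurable_emeasure_kernel[OF measurable_prob_algebraD[OF this] B]
      have "?f \<in> borel_measurable ?P'"
        by (intro borel_measurable_times_ennreal measurable_compose[OF measurable_Pair[OF hist'
          act']] borel_measurable_indicator A)
      then show "?f \<in> borel_measurable ?P'" .
    qed
    finally show ?thesis .
  qed
  ultimately show ?thesis unfolding is_path_law_def using prob' by (simp add: space_prob_algebra)
qed

theorem policy_value_lift:
  assumes D: "cdt_MP D" and S: "S \<in> sets (state_algebra D)" and x: "x \<in> topspace (states D)"
    and \<pi>: "\<pi> \<in> policies D" and \<pi>': "\<pi>' \<in> policies (aux_MP D S)"
    and agree: "\<And>n h. h \<in> space (history_algebra D n) \<Longrightarrow> \<pi> n h = \<pi>' n (lift_history S q n h)"
    and J: "J \<in> borel_measurable (path_algebra (aux_MP D S))"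
    and I: "\<And>\<omega>. \<omega> \<in> space (path_algebra D) \<Longrightarrow> I \<omega> = J (lift_path S q \<omega>)"
  shows "policy_value (aux_MP D S) \<pi>' (x, q) J = policy_value D \<pi> x I"
proof -
  let ?P = "path_law D \<pi> x"
  have P: "is_path_law D \<pi> x ?P" by (rule is_path_law_path_law[OF D \<pi> x])
  then have sP: "sets ?P = sets (path_algebra D)" by (simp add: is_path_law_def space_prob_algebra)
  have sing: "{x} \<in> sets (state_algebra D)" using cdt_MP_D(1)[OF D] x
    by (rule singleton_sets_borel_of)
  note T = cdt_MP_D(5)[OF D]
  have "path_law (aux_MP D S) \<pi>' (x, q) = distr ?P (path_algebra (aux_MP D S)) (lift_path S q)"
    by (rule path_law_eqI[OF kernel_aux_measurable[OF T S] \<pi>' is_path_law_lift[OF T S sing \<pi>'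
      agree P]])
  then have "policy_value (aux_MP D S) \<pi>' (x, q) J = (\<integral>\<^sup>+\<omega>. J (lift_path S q \<omega>) \<partial>?P)"
    unfolding policy_value_def using J measurable_lift_path[OF S]
    by (simp add: nn_integral_distr measurable_cong_sets[OF sP refl])
  also have "\<dots> = policy_value D \<pi> x I"
    unfolding policy_value_def using I sets_eq_imp_space_eq[OF sP] by (intro nn_integral_cong) simp
  finally show ?thesis .
qed

text \<open>
Every policy of the auxiliary process has the same value as its composition with \<open>lift_history\<close>, and
every policy of \<open>D\<close> has the same value as its composition with \<open>forget_history\<close>. So both processes
realise the same set of values.
\<close>

theorem values_lift:
  assumes D: "cdt_MP D" and S: "S \<in> sets (state_algebra D)" and x: "x \<in> topspace (states D)"
    and J: "J \<in> borel_measurable (path_algebra (aux_MP D S))"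
    and I: "\<And>\<omega>. \<omega> \<in> space (path_algebra D) \<Longrightarrow> I \<omega> = J (lift_path S q \<omega>)"
  shows "sup_value (aux_MP D S) (x, q) J = sup_value D x I"
    and "inf_value (aux_MP D S) (x, q) J = inf_value D x I"
proof -
  let ?V = "\<lambda>\<pi>. policy_value D \<pi> x I" and ?V' = "\<lambda>\<pi>. policy_value (aux_MP D S) \<pi> (x, q) J"
  have "?V' ` policies (aux_MP D S) = ?V ` policies D"
  proof (intro equalityI subsetI)
    fix v assume "v \<in> ?V' ` policies (aux_MP D S)"
    then obtain \<pi>' where \<pi>': "\<pi>' \<in> policies (aux_MP D S)" and v: "v = ?V' \<pi>'" by blast
    have "?V' \<pi>' = ?V (\<lambda>n h. \<pi>' n (lift_history S q n h))"
      by (rule policy_value_lift[OF D S x lift_policy[OF \<pi>' S] \<pi>' refl J I])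
    with v lift_policy[OF \<pi>' S] show "v \<in> ?V ` policies D" by blast
  next
    fix v assume "v \<in> ?V ` policies D"
    then obtain \<pi> where \<pi>: "\<pi> \<in> policies D" and v: "v = ?V \<pi>" by blast
    have "?V' (\<lambda>n h. \<pi> n (forget_history n h)) = ?V \<pi>"
      by (rule policy_value_lift[OF D S x \<pi> forget_policy[OF \<pi>] _ J I]) (simp_all add:
        forget_lift_history)
    with v forget_policy[OF \<pi>] show "v \<in> ?V' ` policies (aux_MP D S)"
      by (metis (no_types, lifting) imageI)
  qed
  then show "sup_value (aux_MP D S) (x, q) J = sup_value D x I"
    "inf_value (aux_MP D S) (x, q) J = inf_value D x I"
    by (simp_all add: sup_value_def inf_value_def)
qed

section \<open>The total cost of a lifted path\<close>

lemma measurable_total_cost: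
  assumes G: "G \<in> sets (state_algebra D)"
  shows "total_cost G n \<in> borel_measurable (path_algebra (aux_MP D S))"
proof -
  have eq: "stage_cost G p = indicator (G \<times> {QS}) p" for p
    by (cases p) (auto simp: indicator_def)
  have "G \<times> {QS} \<in> sets (state_algebra (aux_MP D S))"
    unfolding sets_state_algebra_aux using G by (intro pair_measureI) (auto simp: sets_mode_algebra)
  then have "stage_cost G \<in> borel_measurable (state_algebra (aux_MP D S))"
    unfolding eq[abs_def] by (rule borel_measurable_indicator)
  from measurable_compose[OF measurable_state_at this]
  have [measurable]: "(\<lambda>\<omega>. stage_cost G (state_at \<omega> k)) \<in>
      borel_measurable (path_algebra (aux_MP D S))" for k .
  show ?thesis unfolding total_cost_def[abs_def] by (cases n) simp_all
qed

lemma total_cost_lift_QF: "total_cost G n (lift_path S QF \<omega>) = 0"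
  by (cases n) (simp_all add: total_cost_def state_at_lift_path mode_after_QF)

text \<open>
A cost of \<open>1\<close> is incurred at time \<open>k\<close> exactly if \<open>k\<close> is a time at which \<open>G\<close> is reached through \<open>S\<close>.
There cannot be two such times, since the state at the earlier one would lie in both \<open>S\<close> and \<open>G\<close>.
\<close>

lemma total_cost_lift_QS:
  assumes disj: "S \<inter> G = {}" and \<omega>: "\<omega> \<in> space (path_algebra D)"
  shows "total_cost G n (lift_path S QS \<omega>) = indicator (until_event D S n G) \<omega>"
proof -
  let ?hit = "\<lambda>k. state_at \<omega> k \<in> G \<and> (\<forall>j<k. state_at \<omega> j \<in> S)"
  let ?c = "\<lambda>k. stage_cost G (state_at (lift_path S QS \<omega>) k)"
  have c: "?c k = (if ?hit k then 1 else 0)" for k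
    by (auto simp: state_at_lift_path mode_after_QS indicator_def)
  have unique: "i = k" if "?hit i" "?hit k" for i k
    using that disj by (metis disjoint_iff linorder_neqE_nat)
  have until: "\<omega> \<in> until_event D S n G \<longleftrightarrow> (\<exists>i. enat i \<le> n \<and> ?hit i)"
    using \<omega> by (simp add: until_event_def)
  show ?thesis
  proof (cases "\<exists>i. enat i \<le> n \<and> ?hit i")
    case True
    then obtain i where i: "enat i \<le> n" "?hit i" by blast
    have ci: "?c k = (if k = i then 1 else 0)" for k
      unfolding c using i(2) unique by auto
    have "total_cost G n (lift_path S QS \<omega>) = 1"
    proof (cases n)
      case (enat m)
      then show ?thesis using i(1) by (simp add: total_cost_def ci)
    next
      case infinity
      have "(\<Sum>k. ?c k) = (\<Sum>k\<in>{i}. ?c k)" by (rule suminf_finite) (auto simp: ci)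
      then show ?thesis using infinity by (simp add: total_cost_def ci)
    qed
    then show ?thesis using True until by simp
  next
    case False
    then have "?c k = 0" if "enat k \<le> n" for k using that unfolding c by auto
    then have "total_cost G n (lift_path S QS \<omega>) = 0"
      by (cases n) (simp_all add: total_cost_def)
    then show ?thesis using False until by simp
  qed
qed

theorem theorem2:
  fixes D :: "('x, 'u) mp" and S G :: "'x set" and n :: enat and x :: 'x
  assumes "cdt_MP D"
    and "S \<in> sets (borel_of (states D))"
    and "G \<in> sets (borel_of (states D))"
    and "S \<inter> G = {}"
    and "x \<in> topspace (states D)"
  shows "sup_value (aux_MP D S) (x, QF) (total_cost G n) = 0 \<and>
         inf_value (aux_MP D S) (x, QF) (total_cost G n) = 0 \<and>
         sup_value D x (indicator (until_event D S n G)) =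
           sup_value (aux_MP D S) (x, QS) (total_cost G n) \<and>
         inf_value D x (indicator (until_event D S n G)) =
           inf_value (aux_MP D S) (x, QS) (total_cost G n)"
proof -
  note cost = measurable_total_cost[OF assms(3), of n S]
  note QF = values_lift[OF assms(1,2,5) cost total_cost_lift_QF[symmetric]]
  note QS = values_lift[OF assms(1,2,5) cost total_cost_lift_QS[OF assms(4), symmetric]]
  have zero: "policy_value D \<pi> x (\<lambda>_. 0) = 0" for \<pi> by (simp add: policy_value_def)
  have "sup_value D x (\<lambda>_. 0) = 0" "inf_value D x (\<lambda>_. 0) = 0"
    using policies_nonempty[OF assms(1)] by (simp_all add: sup_value_def inf_value_def zero)
  with QF QS show ?thesis by simp
qed

end
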